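(* Let $\mathcal A$ be a hyperplane arrangement with base region $B$. If $\mathcal A$ is tight with respect to $B$, then $(\operatorname{Sh}(\mathcal A,B),\to,\twoheadrightarrow,\hookrightarrow)$ is a two-acyclic factorization system. The map $$R\mapsto\bigl(\{\Sigma\in\operatorname{Sh}(\mathcal A,B): J(\Sigma)\le R\},\ \{\Sigma\in\operatorname{Sh}(\mathcal A,B): M(\Sigma)\ge R\}\bigr)$$ is an isomorphism from $\operatorname{Pos}(\mathcal A,B)$ to $\operatorname{Pairs}(\to)$, with inverse $$(X,Y)\mapsto\bigvee_{\Sigma\in X}J(\Sigma)=\bigwedge_{\Sigma\in Y}M(\Sigma).$$
   Context: Posets of regions: A hyperplane arrangement $\mathcal A$ is a finite collection of linear hyperplanes in $\mathbb R^n$. The regions of $\mathcal A$ are the closures of the connected components of $\mathbb R^n\setminus\bigcup_{H\in\mathcal A}H$; they are full-dimensional polyhedral cones. Fix a region $B$ (the base region). The separating set $S(R)$ of a region $R$ is the set of hyperplanes in $\mathcal A$ that separate $R$ from $B$. $\operatorname{Pos}(\mathcal A,B)$ is the set of regions, partially ordered by containment of separating sets. A facet of $R$ is a lower facet if the hyperplane defining it is in $S(R)$, and an upper facet otherwise. $R$ is tight with respect to $B$ if for every pair of (distinct) lower facets of $R$ their intersection is a codimension-2 face, and for every pair of (distinct) upper facets of $R$ their intersection is a codimension-2 face. $\mathcal A$ is tight with respect to $B$ if every region is tight with respect to $B$; then $\operatorname{Pos}(\mathcal A,B)$ is a lattice. Shards: A rank-two subarrangement of $\mathcal A$ is a subset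 $\mathcal A'\subseteq\mathcal A$ with $|\mathcal A'|\ge2$ such that $\mathcal A'=\{H\in\mathcal A: U\subseteq H\}$ for some codimension-2 subspace $U$. There is a unique $\mathcal A'$-region $B'$ containing $B$; the basic hyperplanes of $\mathcal A'$ are the two hyperplanes defining the facets of $B'$. Distinct $H,H'\in\mathcal A$ lie in a unique rank-two subarrangement $\mathcal A'$; $H'$ cuts $H$ if $H'$ is basic in $\mathcal A'$ and $H$ is not basic in $\mathcal A'$. The shards in $H$ are the closures of the connected components of $H\setminus\bigcup_{H'}(H'\cap H)$, the union over all $H'\in\mathcal A$ that cut $H$. $\operatorname{Sh}(\mathcal A,B)$ is the set of all shards of all hyperplanes of $\mathcal A$. For a shard $\Sigma$ contained in $H$, an upper region (resp. lower region) of $\Sigma$ is a region $R$ whose intersection with $\Sigma$ is $(n-1)$-dimensional and with $H\in S(R)$ (resp. $H\notin S(R)$). When $\mathcal A$ is tight with respect to $B$, it is known that the upper regions of $\Sigma$ contain a unique minimal region $J(\Sigma)$ of $\operatorname{Pos}(\mathcal A,B)$, the lower regions of $\Sigma$ contain a unique maximal region $M(\Sigma)$, and $\Sigma\mapsto J(\Sigma)$, $\Sigma\mapsto M(\Sigma)$ are bijections from shards to join-irreducible and to meet-irreducible elements respectively. Define relations on $\operatorname{Sh}(\mathcal A,B)$: $\Sigma\to\Sigma'$ iff $J(\Sigma)\not\le M(\Sigma')$; $\Sigma\twoheadrightarrow\Sigma'$ iff $J(\Sigma)\ge J(\Sigma')$; $\Sigma\hookrightarrow\Sigma'$ iff $M(\Sigma)\ge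 M(\Sigma')$. Factorization systems: For a binary relation $\to$ on a set $S$ and $X\subseteq S$, put $X^\perp=\{y\in S: x\not\to y\ \forall x\in X\}$ and ${}^\perp X=\{y\in S: y\not\to x\ \forall x\in X\}$. A maximal orthogonal pair is a pair $(X,Y)$ of subsets of $S$ with $Y=X^\perp$ and $X={}^\perp Y$. $\operatorname{Pairs}(\to)$ is the set of maximal orthogonal pairs, partially ordered by containment of first components. For a reflexive relation $\to$ on $S$, $\operatorname{Fact}(\to)=(\twoheadrightarrow,\hookrightarrow)$, where $x\twoheadrightarrow y$ iff for all $z$, $y\to z$ implies $x\to z$, and $x\hookrightarrow y$ iff for all $z$, $z\to x$ implies $z\to y$. For preorders $\twoheadrightarrow,\hookrightarrow$, $\operatorname{Mult}(\twoheadrightarrow,\hookrightarrow)$ is the relation relating $x$ to $z$ iff there is $y\in S$ with $x\twoheadrightarrow y\hookrightarrow z$. A factorization system is a tuple $(S,\to,\twoheadrightarrow,\hookrightarrow)$ with $\to$ reflexive, $\operatorname{Fact}(\to)=(\twoheadrightarrow,\hookrightarrow)$ and $\operatorname{Mult}(\twoheadrightarrow,\hookrightarrow)=\to$. It is two-acyclic if $x\twoheadrightarrow y\twoheadrightarrow x$ implies $x=y$, $x\hookrightarrow y\hookrightarrow x$ implies $x=y$, and $x\twoheadrightarrow y\hookrightarrow x$ implies $x=y$. *)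

theory Defs
  imports "HOL-Analysis.Analysis" "HOL-Algebra.Lattice"
begin

section \<open>Hyperplane arrangements and posets of regions\<close>

definition arrangement :: "'a::euclidean_space set set \<Rightarrow> bool" where
  "arrangement A \<longleftrightarrow> finite A \<and> (\<forall>H\<in>A. subspace H \<and> dim H + 1 = DIM('a))"

definition regions :: "'a::euclidean_space set set \<Rightarrow> 'a set set" where
  "regions A = closure ` components (UNIV - \<Union>A)"

text \<open>The inequalities are weak because regions are closed; for full-dimensional \<open>R\<close> and \<open>Q\<close>
  this says that their interiors lie strictly on opposite sides of \<open>H\<close>.\<close>

definition separates :: "'a::euclidean_space set \<Rightarrow> 'a set \<Rightarrow> 'a set \<Rightarrow> bool" where
  "separates H R Q \<longleftrightarrow>
     (\<exists>a. a \<noteq> 0 \<and> H = {x. a \<bullet> x = 0} \<and> (\<forall>x\<in>R. a \<bullet> x \<le> 0) \<and> (\<forall>x\<in>Q. a \<bullet> x \<ge> 0))"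

definition sep_set :: "'a::euclidean_space set set \<Rightarrow> 'a set \<Rightarrow> 'a set \<Rightarrow> 'a set set" where
  "sep_set A B R = {H\<in>A. separates H R B}"

definition Pos :: "'a::euclidean_space set set \<Rightarrow> 'a set \<Rightarrow> 'a set gorder" where
  "Pos A B = \<lparr>carrier = regions A, eq = (=), le = (\<lambda>R Q. sep_set A B R \<subseteq> sep_set A B Q)\<rparr>"

text \<open>A facet \<open>F\<close> of a full-dimensional polyhedral cone contains \<open>0\<close>, so the linear hyperplane
  defining it is \<open>span F\<close>.\<close>

definition lower_facet :: "'a::euclidean_space set set \<Rightarrow> 'a set \<Rightarrow> 'a set \<Rightarrow> 'a set \<Rightarrow> bool" where
  "lower_facet A B R F \<longleftrightarrow> F facet_of R \<and> span F \<in> sep_set A B R"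

definition upper_facet :: "'a::euclidean_space set set \<Rightarrow> 'a set \<Rightarrow> 'a set \<Rightarrow> 'a set \<Rightarrow> bool" where
  "upper_facet A B R F \<longleftrightarrow> F facet_of R \<and> span F \<notin> sep_set A B R"

definition codim2_face :: "'a::euclidean_space set \<Rightarrow> 'a set \<Rightarrow> bool" where
  "codim2_face F R \<longleftrightarrow> F face_of R \<and> aff_dim F = int DIM('a) - 2"

definition tight_region :: "'a::euclidean_space set set \<Rightarrow> 'a set \<Rightarrow> 'a set \<Rightarrow> bool" where
  "tight_region A B R \<longleftrightarrow>
     (\<forall>F G. lower_facet A B R F \<and> lower_facet A B R G \<and> F \<noteq> G \<longrightarrow> codim2_face (F \<inter> G) R) \<and>
     (\<forall>F G. upper_facet A B R F \<and> upper_facet A B R G \<and> F \<noteq> G \<longrightarrow> codim2_face (F \<inter> G) R)"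

definition tight :: "'a::euclidean_space set set \<Rightarrow> 'a set \<Rightarrow> bool" where
  "tight A B \<longleftrightarrow> (\<forall>R\<in>regions A. tight_region A B R)"

section \<open>Shards\<close>

definition rank_two_subarr :: "'a::euclidean_space set set \<Rightarrow> 'a set set \<Rightarrow> bool" where
  "rank_two_subarr A A' \<longleftrightarrow> A' \<subseteq> A \<and> card A' \<ge> 2 \<and>
     (\<exists>U. subspace U \<and> dim U + 2 = DIM('a) \<and> A' = {H\<in>A. U \<subseteq> H})"

definition basic :: "'a::euclidean_space set set \<Rightarrow> 'a set \<Rightarrow> 'a set \<Rightarrow> bool" where
  "basic A' B H \<longleftrightarrow> (\<exists>B'\<in>regions A'. B \<subseteq> B' \<and> (\<exists>F. F facet_of B' \<and> span F = H))"

definition cuts :: "'a::euclidean_space set set \<Rightarrow> 'a set \<Rightarrow> 'a set \<Rightarrow> 'a set \<Rightarrow> bool" where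
  "cuts A B H' H \<longleftrightarrow> H \<noteq> H' \<and>
     (\<exists>A'. rank_two_subarr A A' \<and> H \<in> A' \<and> H' \<in> A' \<and> basic A' B H' \<and> \<not> basic A' B H)"

definition shards_in :: "'a::euclidean_space set set \<Rightarrow> 'a set \<Rightarrow> 'a set \<Rightarrow> 'a set set" where
  "shards_in A B H = closure ` components (H - (\<Union>H'\<in>{H'\<in>A. cuts A B H' H}. H' \<inter> H))"

definition Sh :: "'a::euclidean_space set set \<Rightarrow> 'a set \<Rightarrow> 'a set set" where
  "Sh A B = (\<Union>H\<in>A. shards_in A B H)"

definition upper_regions :: "'a::euclidean_space set set \<Rightarrow> 'a set \<Rightarrow> 'a set \<Rightarrow> 'a set set" where
  "upper_regions A B \<Sigma> = {R\<in>regions A. aff_dim (R \<inter> \<Sigma>) = int DIM('a) - 1 \<and>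
     (\<exists>H\<in>A. \<Sigma> \<in> shards_in A B H \<and> H \<in> sep_set A B R)}"

definition lower_regions :: "'a::euclidean_space set set \<Rightarrow> 'a set \<Rightarrow> 'a set \<Rightarrow> 'a set set" where
  "lower_regions A B \<Sigma> = {R\<in>regions A. aff_dim (R \<inter> \<Sigma>) = int DIM('a) - 1 \<and>
     (\<exists>H\<in>A. \<Sigma> \<in> shards_in A B H \<and> H \<notin> sep_set A B R)}"

text \<open>The next two definitions are meaningful only when the minimal (maximal) element is unique,
  as it is whenever \<open>A\<close> is tight with respect to \<open>B\<close> and \<open>\<Sigma>\<close> is a shard.\<close>

definition J :: "'a::euclidean_space set set \<Rightarrow> 'a set \<Rightarrow> 'a set \<Rightarrow> 'a set" where
  "J A B \<Sigma> = (THE R. R \<in> upper_regions A B \<Sigma> \<and>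
     (\<forall>Q\<in>upper_regions A B \<Sigma>. Q \<sqsubseteq>\<^bsub>Pos A B\<^esub> R \<longrightarrow> Q = R))"

definition M :: "'a::euclidean_space set set \<Rightarrow> 'a set \<Rightarrow> 'a set \<Rightarrow> 'a set" where
  "M A B \<Sigma> = (THE R. R \<in> lower_regions A B \<Sigma> \<and>
     (\<forall>Q\<in>lower_regions A B \<Sigma>. R \<sqsubseteq>\<^bsub>Pos A B\<^esub> Q \<longrightarrow> Q = R))"

definition shard_to :: "'a::euclidean_space set set \<Rightarrow> 'a set \<Rightarrow> 'a set rel" where
  "shard_to A B = {(\<Sigma>, \<Sigma>'). \<Sigma> \<in> Sh A B \<and> \<Sigma>' \<in> Sh A B \<and> \<not> J A B \<Sigma> \<sqsubseteq>\<^bsub>Pos A B\<^esub> M A B \<Sigma>'}"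

definition shard_onto :: "'a::euclidean_space set set \<Rightarrow> 'a set \<Rightarrow> 'a set rel" where
  "shard_onto A B = {(\<Sigma>, \<Sigma>'). \<Sigma> \<in> Sh A B \<and> \<Sigma>' \<in> Sh A B \<and> J A B \<Sigma>' \<sqsubseteq>\<^bsub>Pos A B\<^esub> J A B \<Sigma>}"

definition shard_into :: "'a::euclidean_space set set \<Rightarrow> 'a set \<Rightarrow> 'a set rel" where
  "shard_into A B = {(\<Sigma>, \<Sigma>'). \<Sigma> \<in> Sh A B \<and> \<Sigma>' \<in> Sh A B \<and> M A B \<Sigma>' \<sqsubseteq>\<^bsub>Pos A B\<^esub> M A B \<Sigma>}"

section \<open>Factorization systems\<close>

definition right_perp :: "'s set \<Rightarrow> 's rel \<Rightarrow> 's set \<Rightarrow> 's set" where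
  "right_perp S r X = {y\<in>S. \<forall>x\<in>X. (x, y) \<notin> r}"

definition left_perp :: "'s set \<Rightarrow> 's rel \<Rightarrow> 's set \<Rightarrow> 's set" where
  "left_perp S r X = {y\<in>S. \<forall>x\<in>X. (y, x) \<notin> r}"

definition Pairs :: "'s set \<Rightarrow> 's rel \<Rightarrow> ('s set \<times> 's set) gorder" where
  "Pairs S r = \<lparr>carrier = {(X, Y). X \<subseteq> S \<and> Y \<subseteq> S \<and> Y = right_perp S r X \<and> X = left_perp S r Y},
     eq = (=), le = (\<lambda>p q. fst p \<subseteq> fst q)\<rparr>"

definition Fact :: "'s set \<Rightarrow> 's rel \<Rightarrow> 's rel \<times> 's rel" where
  "Fact S r =
     ({(x, y). x \<in> S \<and> y \<in> S \<and> (\<forall>z\<in>S. (y, z) \<in> r \<longrightarrow> (x, z) \<in> r)},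
      {(x, y). x \<in> S \<and> y \<in> S \<and> (\<forall>z\<in>S. (z, x) \<in> r \<longrightarrow> (z, y) \<in> r)})"

definition Mult :: "'s set \<Rightarrow> 's rel \<Rightarrow> 's rel \<Rightarrow> 's rel" where
  "Mult S onto into =
     {(x, z). x \<in> S \<and> z \<in> S \<and> (\<exists>y\<in>S. (x, y) \<in> onto \<and> (y, z) \<in> into)}"

definition factorization_system :: "'s set \<Rightarrow> 's rel \<Rightarrow> 's rel \<Rightarrow> 's rel \<Rightarrow> bool" where
  "factorization_system S r onto into \<longleftrightarrow>
     r \<subseteq> S \<times> S \<and> refl_on S r \<and> Fact S r = (onto, into) \<and> Mult S onto into = r"

definition two_acyclic :: "'s rel \<Rightarrow> 's rel \<Rightarrow> bool" where
  "two_acyclic onto into \<longleftrightarrow> antisym onto \<and> antisym into \<and>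
     (\<forall>x y. (x, y) \<in> onto \<and> (y, x) \<in> into \<longrightarrow> x = y)"

section \<open>Isomorphisms of posets\<close>

definition order_iso :: "('a, 'c) gorder_scheme \<Rightarrow> ('b, 'd) gorder_scheme \<Rightarrow> ('a \<Rightarrow> 'b) \<Rightarrow> bool" where
  "order_iso P Q f \<longleftrightarrow> order_emb P Q f \<and> bij_betw f (carrier P) (carrier Q)"

definition region_pair :: "'a::euclidean_space set set \<Rightarrow> 'a set \<Rightarrow> 'a set \<Rightarrow> 'a set set \<times> 'a set set" where
  "region_pair A B R =
     ({\<Sigma>\<in>Sh A B. J A B \<Sigma> \<sqsubseteq>\<^bsub>Pos A B\<^esub> R}, {\<Sigma>\<in>Sh A B. R \<sqsubseteq>\<^bsub>Pos A B\<^esub> M A B \<Sigma>})"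

end

theory Submission
  imports Defs
begin

text \<open>
  Only the separating sets of the regions matter. Tightness says that two upper walls of a region
  span a polygon of regions, so ascending in the poset is locally confluent. Newman's lemma then
  gives joins, and it also gives, for a wall in \<open>n\<close> above a region \<open>a\<close>, a largest region above
  \<open>a\<close> that is not separated by \<open>n\<close>; passing to antipodes gives the dual statement. Moving across
  a polygon changes neither of these extremal regions and crosses no hyperplane that cuts \<open>n\<close>, and
  a generic segment inside a shard moves from wall to wall across such polygons. Hence the extremal
  regions depend only on the shard and are \<open>J\<close> and \<open>M\<close>. Finally, if \<open>u\<close> is not below \<open>v\<close>,
  then a minimal region \<open>j\<close> below \<open>u\<close> and not below \<open>v\<close> has a unique lower wall, whose shard
  \<open>\<Sigma>\<close> satisfies \<open>J \<Sigma> \<le> u\<close> and \<open>v \<le> M \<Sigma>\<close>; the theorem is a formal consequence of this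
  separation property.
\<close>

section \<open>Finite systems of separating sets\<close>

text \<open>Confluence yields an extremal region over one fixed wall, whereas \<open>J\<close> and
  \<open>M\<close> are extremal over all regions along a shard, and two walls of one shard need not
  be comparable. Comparable walls in \<open>n\<close> share their extremal regions by maximality
  alone, so the task is to join any two walls of a shard by comparable steps. Inside the hyperplane
  of \<open>n\<close>, a step across a codimension-two subspace flips all other members of a
  rank-two subarrangement at once. If none of these cuts \<open>n\<close>, then \<open>n\<close> is
  basic there, the other members take the same sign at every point of the hyperplane, and the flip
  is an inclusion. The extremal regions must moreover be adjacent to the shard themselves, which
  also makes \<open>J\<close> and \<open>M\<close> injective. This needs an ascent from a wall to
  its extremal wall that never leaves the shard: \<open>n\<close> and another upper wall
  \<open>k\<close> of the same region are the two ends of their polygon, hence no member of that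
  polygon cuts \<open>n\<close>.\<close>

definition cover_edge :: "'v set set \<Rightarrow> 'v set \<Rightarrow> 'v \<Rightarrow> bool" where
  "cover_edge L a n \<longleftrightarrow> a \<in> L \<and> insert n a \<in> L \<and> n \<notin> a"

text \<open>\<open>L\<close> plays the role of the family of separating sets, \<open>poly k l\<close> that of the rank-two
  subarrangement spanned by \<open>k\<close> and \<open>l\<close>, and a cover edge \<open>(a, n)\<close> that of a facet in \<open>n\<close>
  between the regions \<open>a\<close> and \<open>insert n a\<close>. The assumption \<open>walk\<close> expresses that a shard is
  connected through codimension-two faces.\<close>

locale polygonal_system =
  fixes N :: "'v set" and L :: "'v set set" and poly :: "'v \<Rightarrow> 'v \<Rightarrow> 'v set"
    and cut :: "'v \<Rightarrow> 'v \<Rightarrow> bool"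
  assumes finite_N: "finite N"
    and subset_N: "w \<in> L \<Longrightarrow> w \<subseteq> N"
    and empty_mem: "{} \<in> L"
    and compl_mem: "w \<in> L \<Longrightarrow> N - w \<in> L"
    and chain: "w \<in> L \<Longrightarrow> w' \<in> L \<Longrightarrow> w \<subset> w' \<Longrightarrow> \<exists>k\<in>w' - w. insert k w \<in> L"
    and poly_ends: "k \<in> N \<Longrightarrow> l \<in> N \<Longrightarrow> k \<in> poly k l \<and> l \<in> poly k l"
    and poly_subset: "w \<in> L \<Longrightarrow> k \<in> w \<Longrightarrow> l \<in> w \<Longrightarrow> poly k l \<subseteq> w"
    and poly_top: "cover_edge L w k \<Longrightarrow> cover_edge L w l \<Longrightarrow> k \<noteq> l \<Longrightarrow> w \<union> poly k l \<in> L"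
    and poly_uncut: "cover_edge L w k \<Longrightarrow> cover_edge L w l \<Longrightarrow> k \<noteq> l \<Longrightarrow> m \<in> poly k l \<Longrightarrow> \<not> cut m k"
    and walk: "cover_edge L a n \<Longrightarrow> cover_edge L a' n \<Longrightarrow> \<forall>k. cut k n \<longrightarrow> (k \<in> a \<longleftrightarrow> k \<in> a') \<Longrightarrow> a \<noteq> a' \<Longrightarrow>
      \<exists>c. cover_edge L c n \<and> (\<forall>k. cut k n \<longrightarrow> (k \<in> c \<longleftrightarrow> k \<in> a)) \<and>
        card (sym_diff c a') < card (sym_diff a a') \<and> (a \<subseteq> c \<or> c \<subseteq> a)"
begin

text \<open>For two walls in \<open>n\<close> this is the relation of lying in the same shard, since
  the shards in a hyperplane are separated by the hyperplanes that cut it.\<close>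

definition agree :: "'v \<Rightarrow> 'v set \<Rightarrow> 'v set \<Rightarrow> bool" where
  "agree n a a' \<longleftrightarrow> (\<forall>k. cut k n \<longrightarrow> (k \<in> a \<longleftrightarrow> k \<in> a'))"

text \<open>A union, so that the term makes sense before a largest such member is known to exist. In
  the arrangement it is the separating set of \<open>M\<close> of the shard through the wall
  \<open>(a, n)\<close>; the intersection \<open>downmost\<close>, bounded by the upper side
  \<open>insert n a\<close> of the wall, belongs to \<open>J\<close>.\<close>

definition upmost :: "'v set \<Rightarrow> 'v \<Rightarrow> 'v set" where
  "upmost a n = \<Union>{w \<in> L. a \<subseteq> w \<and> n \<notin> w}"

definition downmost :: "'v set \<Rightarrow> 'v \<Rightarrow> 'v set" where
  "downmost a n = \<Inter>{w \<in> L. w \<subseteq> insert n a \<and> n \<in> w}"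

section \<open>Complementation, confluence and joins\<close>

lemma finite_L: "finite L"
  using finite_N subset_N by (meson PowI finite_Pow_iff finite_subset subsetI)

lemma N_mem: "N \<in> L"
  using compl_mem[OF empty_mem] by simp

lemma poly_disjoint:
  assumes "w \<in> L" "k \<in> N - w" "l \<in> N - w"
  shows "w \<inter> poly k l = {}"
  using poly_subset[OF compl_mem[OF assms(1)] assms(2,3)] by auto

lemma chain_down:
  assumes "w \<in> L" "w' \<in> L" "w \<subset> w'"
  shows "\<exists>k\<in>w' - w. w' - {k} \<in> L"
proof -
  have "N - w' \<subset> N - w"
    using assms subset_N by blast
  then obtain k where k: "k \<in> (N - w) - (N - w')" "insert k (N - w') \<in> L"
    using chain[OF compl_mem[OF assms(2)] compl_mem[OF assms(1)]] by blast
  have "N - insert k (N - w') = w' - {k}"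
    using subset_N[OF assms(2)] by auto
  then show ?thesis
    using compl_mem[OF k(2)] k(1) by auto
qed

lemma cover_edge_compl:
  assumes "cover_edge L a n"
  shows "cover_edge L (N - insert n a) n"
proof -
  have "insert n (N - insert n a) = N - a"
    using assms subset_N unfolding cover_edge_def by blast
  then show ?thesis
    using assms compl_mem unfolding cover_edge_def by auto
qed

text \<open>This is Newman's lemma: the covering relation restricted to \<open>D\<close> terminates and is locally
  confluent, so all ascending chains in \<open>D\<close> from \<open>a\<close> lead to the same maximal element.\<close>

lemma max_of_confluent:
  assumes D: "D \<subseteq> L" "a \<in> D"
    and convex: "\<And>w w'. w \<in> D \<Longrightarrow> w' \<in> L \<Longrightarrow> a \<subseteq> w' \<Longrightarrow> w' \<subseteq> w \<Longrightarrow> w' \<in> D"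
    and confl: "\<And>w k l. a \<subseteq> w \<Longrightarrow> insert k w \<in> D \<Longrightarrow> insert l w \<in> D \<Longrightarrow>
      cover_edge L w k \<Longrightarrow> cover_edge L w l \<Longrightarrow> k \<noteq> l \<Longrightarrow> w \<union> poly k l \<in> D"
  shows "\<exists>m\<in>D. \<forall>w\<in>D. a \<subseteq> w \<longrightarrow> w \<subseteq> m"
proof -
  have "\<exists>m\<in>D. x \<subseteq> m \<and> (\<forall>w\<in>D. x \<subseteq> w \<longrightarrow> w \<subseteq> m)" if "x \<in> D" "a \<subseteq> x" for x
    using that
  proof (induction "card (N - x)" arbitrary: x rule: less_induct)
    case less
    have step: "\<exists>k. k \<in> w \<and> k \<notin> x \<and> insert k x \<in> D" if w: "w \<in> D" "x \<subseteq> w" "x \<noteq> w" for w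
    proof -
      obtain k where k: "k \<in> w - x" "insert k x \<in> L"
        using chain[of x w] w less.prems D by auto
      moreover have "insert k x \<in> D"
        using convex[OF w(1) k(2)] k(1) w(2) less.prems(2) by auto
      ultimately show ?thesis
        by blast
    qed
    have IH: "\<exists>m\<in>D. y \<subseteq> m \<and> (\<forall>w\<in>D. y \<subseteq> w \<longrightarrow> w \<subseteq> m)" if "y \<in> D" "x \<subset> y" for y
    proof -
      have "y \<subseteq> N"
        using that D subset_N by blast
      then have "N - y \<subset> N - x"
        using that by blast
      then have "card (N - y) < card (N - x)"
        using finite_N by (simp add: psubset_card_mono)
      then show ?thesis
        using less that by blast
    qed
    show ?case
    proof (cases "\<exists>k. k \<notin> x \<and> insert k x \<in> D")
      case False
      then have "\<forall>w\<in>D. x \<subseteq> w \<longrightarrow> w = x"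
        using step by metis
      then show ?thesis
        using less.prems by auto
    next
      case True
      then obtain k where k: "k \<notin> x" "insert k x \<in> D"
        by blast
      have xk: "x \<subset> insert k x"
        using k(1) by blast
      obtain m where m: "m \<in> D" "insert k x \<subseteq> m" "\<And>w. w \<in> D \<Longrightarrow> insert k x \<subseteq> w \<Longrightarrow> w \<subseteq> m"
        using IH[OF k(2) xk] by metis
      have "w \<subseteq> m" if w: "w \<in> D" "x \<subseteq> w" for w
      proof (cases "x = w")
        case True
        then show ?thesis using m by auto
      next
        case False
        then obtain l where l: "l \<in> w" "l \<notin> x" "insert l x \<in> D"
          using step w by blast
        show ?thesis
        proof (cases "l = k")
          case True
          then show ?thesis using m w l by auto
        next
          case False
          have xl: "x \<subset> insert l x"
            using l(2) by blast
          obtain m' where m': "m' \<in> D" "insert l x \<subseteq> m'" "\<And>w. w \<in> D \<Longrightarrow> insert l x \<subseteq> w \<Longrightarrow> w \<subseteq> m'"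
            using IH[OF l(3) xl] by metis
          have e: "cover_edge L x k" "cover_edge L x l"
            using k l less.prems D unfolding cover_edge_def by auto
          define y where "y = x \<union> poly k l"
          have y: "y \<in> D"
            using confl e False less.prems k l unfolding y_def by blast
          have "k \<in> N" "l \<in> N"
            using k l D subset_N by blast+
          then have sub: "insert k x \<subseteq> y" "insert l x \<subseteq> y"
            using poly_ends[of k l] unfolding y_def by auto
          then have xy: "x \<subset> y"
            using xk by blast
          obtain u where u: "u \<in> D" "y \<subseteq> u" "\<And>w. w \<in> D \<Longrightarrow> y \<subseteq> w \<Longrightarrow> w \<subseteq> u"
            using IH[OF y xy] by metis
          \<comment> \<open>The maxima above the two covers \<open>insert l x\<close> and
            \<open>insert k x\<close> are compared through the maximum \<open>u\<close> above the
            top \<open>y\<close> of their polygon.\<close>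
          have "w \<subseteq> m'" using m'(3) w l(1) by simp
          also have "m' \<subseteq> u" using m'(1) m'(3)[OF y sub(2)] u(3) by blast
          also have "u \<subseteq> m" using m(3)[OF u(1) subset_trans[OF sub(1) u(2)]] .
          finally show ?thesis .
        qed
      qed
      then show ?thesis
        using m by blast
    qed
  qed
  then show ?thesis
    using D by blast
qed

text \<open>The join is the complement of the greatest common lower bound of the complements.
  Confluence applies to these lower bounds because \<open>poly_subset\<close> places a whole polygon
  inside \<open>N - x\<close> as soon as its two ends lie there.\<close>

lemma ex_lub:
  assumes "X \<subseteq> L"
  shows "\<exists>s\<in>L. (\<forall>x\<in>X. x \<subseteq> s) \<and> (\<forall>u\<in>L. (\<forall>x\<in>X. x \<subseteq> u) \<longrightarrow> s \<subseteq> u)"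
proof -
  define D where "D = {w \<in> L. \<forall>x\<in>X. w \<subseteq> N - x}"
  have "\<exists>m\<in>D. \<forall>w\<in>D. {} \<subseteq> w \<longrightarrow> w \<subseteq> m"
  proof (rule max_of_confluent)
    show "w \<union> poly k l \<in> D"
      if "insert k w \<in> D" "insert l w \<in> D" "cover_edge L w k" "cover_edge L w l" "k \<noteq> l" for w k l
    proof -
      have "poly k l \<subseteq> N - x" if "x \<in> X" for x
        using poly_subset[of "N - x" k l] compl_mem \<open>insert k w \<in> D\<close> \<open>insert l w \<in> D\<close> that assms
        unfolding D_def by blast
      then show ?thesis
        using that poly_top unfolding D_def by auto
    qed
  qed (use empty_mem in \<open>auto simp: D_def\<close>)
  then obtain m where m: "m \<in> D" "\<And>w. w \<in> D \<Longrightarrow> w \<subseteq> m"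
    by blast
  have "N - m \<subseteq> u" if "u \<in> L" "\<forall>x\<in>X. x \<subseteq> u" for u
    using m(2)[of "N - u"] that compl_mem unfolding D_def by blast
  moreover have "x \<subseteq> N - m" if "x \<in> X" for x
    using m(1) that assms subset_N unfolding D_def by blast
  moreover have "N - m \<in> L"
    using m(1) compl_mem unfolding D_def by blast
  ultimately show ?thesis
    by blast
qed

section \<open>Extremal regions over a wall\<close>

lemma upmost:
  assumes "cover_edge L a n"
  shows "upmost a n \<in> L" "a \<subseteq> upmost a n" "n \<notin> upmost a n"
    "\<And>w. w \<in> L \<Longrightarrow> a \<subseteq> w \<Longrightarrow> n \<notin> w \<Longrightarrow> w \<subseteq> upmost a n"
    "insert n (upmost a n) \<in> L"
proof -
  define D where "D = {w \<in> L. a \<subseteq> w \<and> n \<notin> w}"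
  have a: "a \<in> L" "insert n a \<in> L" "n \<notin> a"
    using assms unfolding cover_edge_def by auto
  have "\<exists>m\<in>D. \<forall>w\<in>D. a \<subseteq> w \<longrightarrow> w \<subseteq> m"
  proof (rule max_of_confluent)
    show "w \<union> poly k l \<in> D"
      if "insert k w \<in> D" "insert l w \<in> D" "cover_edge L w k" "cover_edge L w l" "k \<noteq> l" for w k l
    proof -
      \<comment> \<open>Both walls avoid the region \<open>insert n a\<close>, and so does their
        polygon; since \<open>n\<close> belongs to that region, passing to the top of the polygon
        does not cross \<open>n\<close>.\<close>
      have "k \<in> N - insert n a" "l \<in> N - insert n a"
        using that subset_N unfolding D_def cover_edge_def by blast+
      then have "n \<notin> poly k l"
        using poly_disjoint[OF a(2)] by blast
      then show ?thesis
        using that poly_top unfolding D_def by auto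
    qed
  qed (use a in \<open>auto simp: D_def\<close>)
  then obtain m where m: "m \<in> D" "\<forall>w\<in>D. a \<subseteq> w \<longrightarrow> w \<subseteq> m"
    by blast
  have eq: "upmost a n = m"
    using m unfolding upmost_def D_def by blast
  show 1: "upmost a n \<in> L" "a \<subseteq> upmost a n" "n \<notin> upmost a n"
    using m unfolding eq D_def by auto
  show 2: "\<And>w. w \<in> L \<Longrightarrow> a \<subseteq> w \<Longrightarrow> n \<notin> w \<Longrightarrow> w \<subseteq> upmost a n"
    using m unfolding eq D_def by auto
  have "n \<in> N"
    using a subset_N by blast
  then obtain k where k: "k \<in> N - upmost a n" "insert k (upmost a n) \<in> L"
    using chain[OF 1(1) N_mem] 1 subset_N by blast
  \<comment> \<open>An upper cover of the maximum that still avoided \<open>n\<close> would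
    contradict maximality; thus \<open>n\<close> is the only upper wall of
    \<open>upmost a n\<close>.\<close>
  then have "k = n"
    using 2[OF k(2)] 1 by blast
  then show "insert n (upmost a n) \<in> L"
    using k by simp
qed

lemma cover_edge_upmost: "cover_edge L a n \<Longrightarrow> cover_edge L (upmost a n) n"
  using upmost(1,3,5) unfolding cover_edge_def by blast

lemma upmost_mono_eq:
  assumes "cover_edge L a n" "cover_edge L c n" "a \<subseteq> c"
  shows "upmost c n = upmost a n"
proof
  have c: "c \<in> L" "n \<notin> c"
    using assms(2) unfolding cover_edge_def by auto
  show "upmost c n \<subseteq> upmost a n"
    using upmost(4)[OF assms(1) upmost(1)[OF assms(2)]] upmost(2,3)[OF assms(2)] assms(3) by blast
  have "c \<subseteq> upmost a n"
    using upmost(4)[OF assms(1) c(1) assms(3) c(2)] .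
  then show "upmost a n \<subseteq> upmost c n"
    using upmost(4)[OF assms(2) upmost(1)[OF assms(1)]] upmost(3)[OF assms(1)] by blast
qed

text \<open>An ascent inside the shard. If \<open>a\<close> is not yet maximal, it has another upper
  wall \<open>k\<close> below the maximum. The polygon of \<open>n\<close> and \<open>k\<close> has
  a wall in \<open>n\<close> on its far side, between \<open>c\<close> and the top \<open>P\<close>;
  it is reached from \<open>a\<close> by crossing only members of the polygon, none of which cuts
  \<open>n\<close>.\<close>

lemma agree_upmost:
  assumes "cover_edge L a n"
  shows "agree n a (upmost a n)"
  using assms
proof (induction "card (N - a)" arbitrary: a rule: less_induct)
  case less
  note a = less.prems
  show ?case
  proof (cases "a = upmost a n")
    case True
    then show ?thesis unfolding agree_def by simp
  next
    case False
    have aL: "a \<in> L" "insert n a \<in> L" "n \<notin> a"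
      using a unfolding cover_edge_def by auto
    obtain k where k: "k \<in> upmost a n - a" "insert k a \<in> L"
      using chain[OF aL(1) upmost(1)[OF a]] upmost(2)[OF a] False by blast
    have kn: "k \<noteq> n" "k \<in> N" "n \<in> N"
      using upmost(1-3)[OF a] k subset_N aL by blast+
    have ek: "cover_edge L a k"
      using aL k unfolding cover_edge_def by auto
    define P where "P = a \<union> poly n k"
    have P: "P \<in> L"
      using poly_top[OF a ek] kn unfolding P_def by blast
    have ends: "n \<in> poly n k" "k \<in> poly n k"
      using poly_ends kn by blast+
    have "n \<notin> insert k a" "insert k a \<subseteq> P" "n \<in> P"
      using ends aL kn unfolding P_def by auto
    then obtain l where l: "l \<in> P - insert k a" "P - {l} \<in> L"
      using chain_down[OF k(2) P] by blast
    \<comment> \<open>Any other \<open>l\<close> would leave both ends \<open>n\<close> and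
      \<open>k\<close> in \<open>P - {l}\<close>, hence the whole polygon and with it
      \<open>l\<close>.\<close>
    have "l = n"
    proof (rule ccontr)
      assume "l \<noteq> n"
      then have "poly n k \<subseteq> P - {l}"
        using poly_subset[OF l(2), of n k] ends l kn unfolding P_def by blast
      then show False
        using l unfolding P_def by blast
    qed
    define c where "c = P - {n}"
    have c: "cover_edge L c n"
      using l \<open>l = n\<close> P ends unfolding cover_edge_def c_def P_def by (auto simp: insert_absorb)
    have ac: "a \<subseteq> c" "k \<in> c" "c \<subseteq> N"
      using aL ends kn l \<open>l = n\<close> subset_N unfolding c_def P_def by blast+
    have "N - c \<subset> N - a"
      using ac k by blast
    then have "card (N - c) < card (N - a)"
      using finite_N by (simp add: psubset_card_mono)
    then have "agree n c (upmost c n)"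
      using less.hyps c by blast
    moreover have "upmost c n = upmost a n"
      using upmost_mono_eq[OF a c] ac by blast
    moreover have "agree n a c"
      using poly_uncut[OF a ek] kn aL(3) unfolding agree_def c_def P_def by blast
    ultimately show ?thesis
      unfolding agree_def by simp
  qed
qed

text \<open>The antipodal map reverses inclusion and sends the lower side of the wall
  \<open>(a, n)\<close> to \<open>insert n (N - insert n a)\<close>, so every fact about
  \<open>upmost\<close> has its dual.\<close>

lemma downmost_eq:
  assumes "cover_edge L a n"
  shows "downmost a n = N - upmost (N - insert n a) n"
proof -
  let ?b = "N - insert n a"
  note b = cover_edge_compl[OF assms]
  have n: "n \<in> N" "insert n a \<in> L"
    using assms subset_N unfolding cover_edge_def by blast+
  have "N - upmost ?b n \<in> {w \<in> L. w \<subseteq> insert n a \<and> n \<in> w}"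
    using upmost(1-3)[OF b] compl_mem n by auto
  moreover have "N - upmost ?b n \<subseteq> w" if w: "w \<in> L" "w \<subseteq> insert n a" "n \<in> w" for w
    using upmost(4)[OF b compl_mem[OF w(1)]] w by blast
  ultimately show ?thesis
    unfolding downmost_def by blast
qed

lemma downmost:
  assumes "cover_edge L a n"
  shows "downmost a n \<in> L" "downmost a n \<subseteq> insert n a" "n \<in> downmost a n"
    "\<And>w. w \<in> L \<Longrightarrow> w \<subseteq> insert n a \<Longrightarrow> n \<in> w \<Longrightarrow> downmost a n \<subseteq> w"
    "downmost a n - {n} \<in> L"
proof -
  note b = upmost[OF cover_edge_compl[OF assms]]
  have n: "n \<in> N" "insert n a \<in> L"
    using assms subset_N unfolding cover_edge_def by blast+
  show "downmost a n \<in> L" "downmost a n \<subseteq> insert n a" "n \<in> downmost a n"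
    using b(1-3) n compl_mem unfolding downmost_eq[OF assms] by auto
  show "\<And>w. w \<in> L \<Longrightarrow> w \<subseteq> insert n a \<Longrightarrow> n \<in> w \<Longrightarrow> downmost a n \<subseteq> w"
    unfolding downmost_def by blast
  show "downmost a n - {n} \<in> L"
    using compl_mem[OF b(5)] unfolding downmost_eq[OF assms] Diff_insert[of N n "upmost _ _"] .
qed

lemma cover_edge_downmost:
  assumes "cover_edge L a n"
  shows "cover_edge L (downmost a n - {n}) n"
  using downmost(1,3,5)[OF assms] unfolding cover_edge_def by (simp add: insert_absorb)

lemma agree_downmost:
  assumes "cover_edge L a n"
  shows "agree n a (downmost a n - {n})"
proof -
  have "agree n (N - insert n a) (upmost (N - insert n a) n)"
    using agree_upmost[OF cover_edge_compl[OF assms]] .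
  moreover have "a \<subseteq> N" "n \<notin> a"
    using assms subset_N unfolding cover_edge_def by blast+
  ultimately show ?thesis
    unfolding agree_def downmost_eq[OF assms] by blast
qed

lemma downmost_mono_eq:
  assumes "cover_edge L a n" "cover_edge L c n" "a \<subseteq> c"
  shows "downmost c n = downmost a n"
  using upmost_mono_eq[OF cover_edge_compl[OF assms(2)] cover_edge_compl[OF assms(1)]] assms(3)
  unfolding downmost_eq[OF assms(1)] downmost_eq[OF assms(2)] by auto

text \<open>\<open>walk\<close> replaces \<open>a\<close> by a comparable wall of the same shard
  that is strictly closer to \<open>a'\<close>, and comparable walls have equal extremes. Hence the
  extremes are invariants of the shard.\<close>

lemma agree_imp_extremes_eq:
  assumes "cover_edge L a n" "cover_edge L a' n" "agree n a a'"
  shows "upmost a n = upmost a' n \<and> downmost a n = downmost a' n"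
  using assms
proof (induction "card (sym_diff a a')" arbitrary: a rule: less_induct)
  case less
  show ?case
  proof (cases "a = a'")
    case False
    then obtain c where c: "cover_edge L c n" "agree n c a"
      "card (sym_diff c a') < card (sym_diff a a')" "a \<subseteq> c \<or> c \<subseteq> a"
      using walk[OF less.prems(1,2)] less.prems(3) unfolding agree_def by blast
    have "agree n c a'"
      using c(2) less.prems(3) unfolding agree_def by simp
    then have "upmost c n = upmost a' n \<and> downmost c n = downmost a' n"
      using less.hyps c less.prems(2) by blast
    then show ?thesis
      using c(1,4) less.prems(1) upmost_mono_eq downmost_mono_eq by metis
  qed simp
qed

text \<open>\<open>n\<close> is the only lower wall of \<open>downmost a n\<close>: removing another
  one would leave a smaller member of the family whose intersection is \<open>downmost a n\<close>.
  So the region determines \<open>n\<close>, and \<open>agree_downmost\<close> then recovers the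
  shard.\<close>

lemma downmost_inj:
  assumes "cover_edge L a n" "cover_edge L a' n'" "downmost a n = downmost a' n'"
  shows "n = n' \<and> agree n a a'"
proof -
  note d = downmost[OF assms(1)] and d' = downmost[OF assms(2), folded assms(3)]
  have n: "n = n'"
  proof (rule ccontr)
    assume "n \<noteq> n'"
    then have "downmost a n \<subseteq> downmost a n - {n'}"
      using d(2,3) by (intro d(4)[OF d'(5)]) auto
    then show False
      using d'(3) by blast
  qed
  then show ?thesis
    using agree_downmost[OF assms(1)] agree_downmost[OF assms(2)] assms(3)
    unfolding agree_def by simp
qed

lemma upmost_inj:
  assumes "cover_edge L a n" "cover_edge L a' n'" "upmost a n = upmost a' n'"
  shows "n = n' \<and> agree n a a'"
proof -
  note d = upmost[OF assms(1)] and d' = upmost[OF assms(2), folded assms(3)]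
  have n: "n = n'"
  proof (rule ccontr)
    assume "n \<noteq> n'"
    then have "insert n' (upmost a n) \<subseteq> upmost a n"
      using d(2,3) by (intro d(4)[OF d'(5)]) auto
    then show False
      using d'(3) by blast
  qed
  then show ?thesis
    using agree_upmost[OF assms(1)] agree_upmost[OF assms(2)] assms(3)
    unfolding agree_def by simp
qed

lemma separating_edge:
  assumes "u \<in> L" "v \<in> L" "\<not> u \<subseteq> v"
  shows "\<exists>a n. cover_edge L a n \<and> downmost a n \<subseteq> u \<and> v \<subseteq> upmost a n"
proof -
  define F where "F = {j \<in> L. j \<subseteq> u \<and> \<not> j \<subseteq> v}"
  have "finite F" "F \<noteq> {}"
    using finite_L assms unfolding F_def by auto
  then obtain j where j: "j \<in> F" "\<forall>i\<in>F. i \<subseteq> j \<longrightarrow> j = i"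
    using finite_has_minimal by blast
  then have jL: "j \<in> L" "j \<subseteq> u" "\<not> j \<subseteq> v"
    unfolding F_def by auto
  then obtain k where k: "k \<in> j" "j - {k} \<in> L"
    using chain_down[OF empty_mem, of j] by blast
  have "j - {k} \<notin> F"
    using j(2) k by blast
  then have "j - {k} \<subseteq> v"
    using jL k unfolding F_def by blast
  \<comment> \<open>\<open>k\<close> alone keeps \<open>j\<close> from lying below \<open>v\<close>,
    so \<open>v\<close> is one of the members above \<open>j - {k}\<close> that avoid
    \<open>k\<close>, which are all bounded by \<open>upmost (j - {k}) k\<close>.\<close>
  moreover have "k \<notin> v"
    using calculation jL by blast
  moreover have e: "cover_edge L (j - {k}) k"
    using jL k unfolding cover_edge_def by (simp add: insert_absorb)
  ultimately have "v \<subseteq> upmost (j - {k}) k" "downmost (j - {k}) k \<subseteq> u"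
    using upmost(4)[OF e assms(2)] downmost(2)[OF e] k jL by auto
  then show ?thesis
    using e by blast
qed

lemma downmost_not_le_upmost: "cover_edge L a n \<Longrightarrow> \<not> downmost a n \<subseteq> upmost a n"
  using downmost(3) upmost(3) by blast

text \<open>If the first inclusion were strict, some lower cover of \<open>downmost a n\<close> met
  on the way down to \<open>downmost a' n'\<close> would have to remove \<open>n\<close>, the only
  lower wall. Then \<open>downmost a' n'\<close> \<subseteq> \<open>a\<close> \<subseteq>
  \<open>upmost a n\<close> \<subseteq> \<open>upmost a' n'\<close>, which is impossible.\<close>

lemma extremes_acyclic:
  assumes e: "cover_edge L a n" "cover_edge L a' n'"
    and le: "downmost a' n' \<subseteq> downmost a n" "upmost a n \<subseteq> upmost a' n'"
  shows "downmost a n = downmost a' n'"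
proof (rule ccontr)
  note d = downmost[OF e(1)]
  assume "downmost a n \<noteq> downmost a' n'"
  then obtain k where k: "k \<in> downmost a n - downmost a' n'" "downmost a n - {k} \<in> L"
    using chain_down[OF downmost(1)[OF e(2)] d(1)] le by blast
  have "k = n"
    using d(4)[OF k(2)] d(2,3) k(1) by blast
  then have "downmost a' n' \<subseteq> upmost a n"
    using k(1) le(1) d(2) upmost(2)[OF e(1)] by blast
  then show False
    using le(2) downmost_not_le_upmost[OF e(2)] by blast
qed

end

section \<open>Factorization systems from separating pairs\<close>

lemma Pairs_simps:
  "carrier (Pairs S r) = {(X, Y). X \<subseteq> S \<and> Y \<subseteq> S \<and> Y = right_perp S r X \<and> X = left_perp S r Y}"
  "x \<sqsubseteq>\<^bsub>Pairs S r\<^esub> y \<longleftrightarrow> fst x \<subseteq> fst y"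
  "x .=\<^bsub>Pairs S r\<^esub> y \<longleftrightarrow> x = y"
  by (auto simp: Pairs_def)

lemma mem_carrier_Pairs:
  "(X, Y) \<in> carrier (Pairs S r) \<longleftrightarrow>
    X \<subseteq> S \<and> Y \<subseteq> S \<and> Y = right_perp S r X \<and> X = left_perp S r Y"
  by (simp only: Pairs_simps mem_Collect_eq prod.case)

lemma weak_partial_order_Pairs: "weak_partial_order (Pairs S r)"
  by unfold_locales (auto simp: Pairs_simps)

text \<open>The purely order-theoretic setting, with \<open>jn\<close> and \<open>mt\<close> in the
  roles of \<open>J\<close> and \<open>M\<close>. Together, \<open>separating\<close> and
  \<open>not_le\<close> say that \<open>u\<close> fails to be below \<open>v\<close> exactly when
  some \<open>x\<close> has \<open>jn x\<close> below \<open>u\<close> and \<open>mt x\<close> above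
  \<open>v\<close>.\<close>

locale separating_pairs = partial_order P for P :: "('r, 'm) gorder_scheme" (structure) +
  fixes S :: "'s set" and jn mt :: "'s \<Rightarrow> 'r"
  assumes jn_closed: "x \<in> S \<Longrightarrow> jn x \<in> carrier P"
    and mt_closed: "x \<in> S \<Longrightarrow> mt x \<in> carrier P"
    and not_le: "x \<in> S \<Longrightarrow> \<not> jn x \<sqsubseteq> mt x"
    and separating: "u \<in> carrier P \<Longrightarrow> v \<in> carrier P \<Longrightarrow> \<not> u \<sqsubseteq> v \<Longrightarrow>
      \<exists>x\<in>S. jn x \<sqsubseteq> u \<and> v \<sqsubseteq> mt x"
    and jn_inj: "x \<in> S \<Longrightarrow> y \<in> S \<Longrightarrow> jn x = jn y \<Longrightarrow> x = y"
    and mt_inj: "x \<in> S \<Longrightarrow> y \<in> S \<Longrightarrow> mt x = mt y \<Longrightarrow> x = y"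
    and acyclic_pair: "x \<in> S \<Longrightarrow> y \<in> S \<Longrightarrow> jn y \<sqsubseteq> jn x \<Longrightarrow> mt x \<sqsubseteq> mt y \<Longrightarrow> x = y"
    and ex_is_lub: "X \<subseteq> carrier P \<Longrightarrow> \<exists>s. is_lub P s X"
begin

definition arrow :: "'s rel" where
  "arrow = {(x, y). x \<in> S \<and> y \<in> S \<and> \<not> jn x \<sqsubseteq> mt y}"

definition onto :: "'s rel" where
  "onto = {(x, y). x \<in> S \<and> y \<in> S \<and> jn y \<sqsubseteq> jn x}"

definition into :: "'s rel" where
  "into = {(x, y). x \<in> S \<and> y \<in> S \<and> mt y \<sqsubseteq> mt x}"

definition pair :: "'r \<Rightarrow> 's set \<times> 's set" where
  "pair R = ({x \<in> S. jn x \<sqsubseteq> R}, {x \<in> S. R \<sqsubseteq> mt x})"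

text \<open>For \<open>Fact\<close>, suppose that \<open>y\<close> has no arrow that
  \<open>x\<close> lacks and that \<open>jn y\<close> is not below \<open>jn x\<close>. A separating
  \<open>z\<close> has no arrow from \<open>x\<close>, hence none from \<open>y\<close>, so
  \<open>jn z\<close> \<le> \<open>jn y\<close> \<le> \<open>mt z\<close>, against
  \<open>not_le\<close>. The other relation is dual.\<close>

lemma factorization_system: "factorization_system S arrow onto into"
proof -
  have "jn y \<sqsubseteq> jn x" if xy: "x \<in> S" "y \<in> S" "\<forall>z\<in>S. (y, z) \<in> arrow \<longrightarrow> (x, z) \<in> arrow" for x y
  proof (rule ccontr)
    assume "\<not> jn y \<sqsubseteq> jn x"
    then obtain z where z: "z \<in> S" "jn z \<sqsubseteq> jn y" "jn x \<sqsubseteq> mt z"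
      using separating[of "jn y" "jn x"] xy jn_closed by blast
    then have "jn y \<sqsubseteq> mt z"
      using xy z unfolding arrow_def by blast
    then show False
      using le_trans[of "jn z" "jn y" "mt z"] z xy jn_closed mt_closed not_le by blast
  qed
  moreover have "(x, z) \<in> arrow" if "x \<in> S" "y \<in> S" "jn y \<sqsubseteq> jn x" "(y, z) \<in> arrow" for x y z
    using that le_trans[of "jn y" "jn x" "mt z"] jn_closed mt_closed unfolding arrow_def by blast
  moreover have "mt y \<sqsubseteq> mt x" if xy: "x \<in> S" "y \<in> S" "\<forall>z\<in>S. (z, x) \<in> arrow \<longrightarrow> (z, y) \<in> arrow" for x y
  proof (rule ccontr)
    assume "\<not> mt y \<sqsubseteq> mt x"
    then obtain z where z: "z \<in> S" "jn z \<sqsubseteq> mt y" "mt x \<sqsubseteq> mt z"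
      using separating[of "mt y" "mt x"] xy mt_closed by blast
    then have "jn z \<sqsubseteq> mt x"
      using xy z unfolding arrow_def by blast
    then show False
      using le_trans[of "jn z" "mt x" "mt z"] z xy jn_closed mt_closed not_le by blast
  qed
  moreover have "(z, y) \<in> arrow" if "x \<in> S" "y \<in> S" "mt y \<sqsubseteq> mt x" "(z, x) \<in> arrow" for x y z
    using that le_trans[of "jn z" "mt y" "mt x"] jn_closed mt_closed unfolding arrow_def by blast
  ultimately have
    1: "\<And>x y. x \<in> S \<Longrightarrow> y \<in> S \<Longrightarrow> (\<forall>z\<in>S. (y, z) \<in> arrow \<longrightarrow> (x, z) \<in> arrow) \<longleftrightarrow> jn y \<sqsubseteq> jn x" and
    2: "\<And>x y. x \<in> S \<Longrightarrow> y \<in> S \<Longrightarrow> (\<forall>z\<in>S. (z, x) \<in> arrow \<longrightarrow> (z, y) \<in> arrow) \<longleftrightarrow> mt y \<sqsubseteq> mt x"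
    by metis+
  have "Fact S arrow = (onto, into)"
    unfolding Fact_def onto_def into_def by (simp only: 1 2 cong: conj_cong)
  moreover have "Mult S onto into = arrow"
  proof (intro Set.set_eqI iffI; clarify)
    fix x z
    assume "(x, z) \<in> Mult S onto into"
    then obtain y where y: "x \<in> S" "z \<in> S" "y \<in> S" "jn y \<sqsubseteq> jn x" "mt z \<sqsubseteq> mt y"
      unfolding Mult_def onto_def into_def by blast
    have "\<not> jn x \<sqsubseteq> mt z"
    proof
      assume "jn x \<sqsubseteq> mt z"
      then have "jn y \<sqsubseteq> mt z"
        using y le_trans[of "jn y" "jn x" "mt z"] jn_closed mt_closed by blast
      then have "jn y \<sqsubseteq> mt y"
        using y le_trans[of "jn y" "mt z" "mt y"] jn_closed mt_closed by blast
      then show False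
        using not_le y by blast
    qed
    then show "(x, z) \<in> arrow"
      using y unfolding arrow_def by blast
  next
    fix x z
    assume "(x, z) \<in> arrow"
    \<comment> \<open>The element separating \<open>jn x\<close> from \<open>mt z\<close> is the
      middle term of the factorization.\<close>
    then show "(x, z) \<in> Mult S onto into"
      using separating[of "jn x" "mt z"] jn_closed mt_closed
      unfolding Mult_def arrow_def onto_def into_def by blast
  qed
  ultimately show ?thesis
    using not_le unfolding factorization_system_def by (auto simp: arrow_def refl_on_def)
qed

lemma two_acyclic: "two_acyclic onto into"
proof -
  have "antisym onto"
    using jn_inj jn_closed le_antisym unfolding antisym_def onto_def by blast
  moreover have "antisym into"
    using mt_inj mt_closed le_antisym unfolding antisym_def into_def by blast
  ultimately show ?thesis
    using acyclic_pair unfolding two_acyclic_def onto_def into_def by blast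
qed

text \<open>In the nontrivial inclusion, an element \<open>y\<close> separating \<open>R\<close>
  from \<open>mt z\<close> would itself lie below \<open>R\<close>, and orthogonality would give
  \<open>jn y\<close> \<le> \<open>mt z\<close> \<le> \<open>mt y\<close>.\<close>

lemma right_perp_below:
  assumes "R \<in> carrier P"
  shows "right_perp S arrow {x \<in> S. jn x \<sqsubseteq> R} = {x \<in> S. R \<sqsubseteq> mt x}"
proof (intro Set.set_eqI iffI)
  fix z
  assume "z \<in> {x \<in> S. R \<sqsubseteq> mt x}"
  then show "z \<in> right_perp S arrow {x \<in> S. jn x \<sqsubseteq> R}"
    using assms le_trans[of _ R "mt z"] jn_closed mt_closed unfolding right_perp_def arrow_def by blast
next
  fix z
  assume z: "z \<in> right_perp S arrow {x \<in> S. jn x \<sqsubseteq> R}"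
  then have zS: "z \<in> S"
    unfolding right_perp_def by blast
  have "R \<sqsubseteq> mt z"
  proof (rule ccontr)
    assume "\<not> R \<sqsubseteq> mt z"
    then obtain y where y: "y \<in> S" "jn y \<sqsubseteq> R" "mt z \<sqsubseteq> mt y"
      using separating[OF assms mt_closed[OF zS]] by blast
    then have "jn y \<sqsubseteq> mt z"
      using z unfolding right_perp_def arrow_def by blast
    then show False
      using y le_trans[of "jn y" "mt z" "mt y"] jn_closed mt_closed not_le zS by blast
  qed
  then show "z \<in> {x \<in> S. R \<sqsubseteq> mt x}"
    using zS by blast
qed

lemma left_perp_above:
  assumes "R \<in> carrier P"
  shows "left_perp S arrow {x \<in> S. R \<sqsubseteq> mt x} = {x \<in> S. jn x \<sqsubseteq> R}"
proof (intro Set.set_eqI iffI)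
  fix z
  assume "z \<in> {x \<in> S. jn x \<sqsubseteq> R}"
  then show "z \<in> left_perp S arrow {x \<in> S. R \<sqsubseteq> mt x}"
    using assms le_trans[of "jn z" R] jn_closed mt_closed unfolding left_perp_def arrow_def by blast
next
  fix z
  assume z: "z \<in> left_perp S arrow {x \<in> S. R \<sqsubseteq> mt x}"
  then have zS: "z \<in> S"
    unfolding left_perp_def by blast
  have "jn z \<sqsubseteq> R"
  proof (rule ccontr)
    assume "\<not> jn z \<sqsubseteq> R"
    then obtain y where y: "y \<in> S" "jn y \<sqsubseteq> jn z" "R \<sqsubseteq> mt y"
      using separating[OF jn_closed[OF zS] assms] by blast
    then have "jn z \<sqsubseteq> mt y"
      using z unfolding left_perp_def arrow_def by blast
    then show False
      using y le_trans[of "jn y" "jn z" "mt y"] jn_closed mt_closed not_le zS by blast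
  qed
  then show "z \<in> {x \<in> S. jn x \<sqsubseteq> R}"
    using zS by blast
qed

section \<open>The isomorphism with maximal orthogonal pairs\<close>

lemma pair_carrier: "R \<in> carrier P \<Longrightarrow> pair R \<in> carrier (Pairs S arrow)"
  using right_perp_below left_perp_above unfolding pair_def Pairs_simps by auto

lemma le_iff_below:
  assumes "R \<in> carrier P" "Q \<in> carrier P"
  shows "R \<sqsubseteq> Q \<longleftrightarrow> {x \<in> S. jn x \<sqsubseteq> R} \<subseteq> {x \<in> S. jn x \<sqsubseteq> Q}"
proof
  assume "R \<sqsubseteq> Q"
  then show "{x \<in> S. jn x \<sqsubseteq> R} \<subseteq> {x \<in> S. jn x \<sqsubseteq> Q}"
    using assms le_trans[of _ R Q] jn_closed by blast
next
  assume sub: "{x \<in> S. jn x \<sqsubseteq> R} \<subseteq> {x \<in> S. jn x \<sqsubseteq> Q}"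
  show "R \<sqsubseteq> Q"
  proof (rule ccontr)
    assume "\<not> R \<sqsubseteq> Q"
    then obtain x where x: "x \<in> S" "jn x \<sqsubseteq> R" "Q \<sqsubseteq> mt x"
      using separating assms by blast
    then have "jn x \<sqsubseteq> mt x"
      using sub assms le_trans[of "jn x" Q "mt x"] jn_closed mt_closed by blast
    then show False
      using not_le x by blast
  qed
qed

lemma pair_inj: "inj_on pair (carrier P)"
proof (rule inj_onI)
  fix R Q
  assume "R \<in> carrier P" "Q \<in> carrier P" "pair R = pair Q"
  then show "R = Q"
    using le_iff_below[of R Q] le_iff_below[of Q R] le_antisym unfolding pair_def by auto
qed

lemma pair_of_lub:
  assumes XY: "(X, Y) \<in> carrier (Pairs S arrow)" and R: "is_lub P R (jn ` X)"
  shows "pair R = (X, Y)" "R \<in> carrier P" "is_glb P R (mt ` Y)"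
proof -
  note X = XY[unfolded mem_carrier_Pairs, THEN conjunct1]
    XY[unfolded mem_carrier_Pairs, THEN conjunct2, THEN conjunct1]
    XY[unfolded mem_carrier_Pairs, THEN conjunct2, THEN conjunct2, THEN conjunct1]
    XY[unfolded mem_carrier_Pairs, THEN conjunct2, THEN conjunct2, THEN conjunct2]
  have jX: "jn ` X \<subseteq> carrier P"
    using X jn_closed by blast
  show RP: "R \<in> carrier P"
    using R unfolding least_def by blast
  have "R \<sqsubseteq> mt z \<longleftrightarrow> (\<forall>x\<in>X. jn x \<sqsubseteq> mt z)" if "z \<in> S" for z
  proof
    assume le: "R \<sqsubseteq> mt z"
    show "\<forall>x\<in>X. jn x \<sqsubseteq> mt z"
    proof
      fix x
      assume "x \<in> X"
      then have "jn x \<in> carrier P" "jn x \<sqsubseteq> R"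
        using R jX unfolding least_def Upper_def by blast+
      then show "jn x \<sqsubseteq> mt z"
        using le_trans[OF _ le] RP mt_closed[OF that] by blast
    qed
  next
    assume "\<forall>x\<in>X. jn x \<sqsubseteq> mt z"
    then have "mt z \<in> Upper P (jn ` X)"
      using mt_closed that unfolding Upper_def by blast
    then show "R \<sqsubseteq> mt z"
      using R unfolding least_def by blast
  qed
  then have "z \<in> right_perp S arrow X \<longleftrightarrow> z \<in> S \<and> R \<sqsubseteq> mt z" for z
    using X(1) unfolding right_perp_def arrow_def by (cases "z \<in> S") auto
  then have Y: "Y = {x \<in> S. R \<sqsubseteq> mt x}"
    using X(3) by blast
  then show "pair R = (X, Y)"
    using left_perp_above[OF RP] X(4) unfolding pair_def by simp
  have "R \<in> Lower P (mt ` Y)"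
    using RP Y unfolding Lower_def by blast
  moreover have "w \<sqsubseteq> R" if w: "w \<in> Lower P (mt ` Y)" for w
  proof (rule ccontr)
    have wP: "w \<in> carrier P"
      using w unfolding Lower_def by blast
    assume "\<not> w \<sqsubseteq> R"
    then obtain x where x: "x \<in> S" "jn x \<sqsubseteq> w" "R \<sqsubseteq> mt x"
      using separating wP RP by blast
    then have "w \<sqsubseteq> mt x"
      using w Y mt_closed unfolding Lower_def by blast
    then show False
      using x le_trans[of "jn x" w "mt x"] wP jn_closed mt_closed not_le by blast
  qed
  ultimately show "is_glb P R (mt ` Y)"
    unfolding greatest_def by auto
qed

lemma order_iso_pair: "order_iso P (Pairs S arrow) pair"
proof -
  have "(X, Y) \<in> pair ` carrier P" if "(X, Y) \<in> carrier (Pairs S arrow)" for X Y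
  proof -
    have "jn ` X \<subseteq> carrier P"
      using that[unfolded mem_carrier_Pairs, THEN conjunct1] jn_closed by blast
    then obtain R where "is_lub P R (jn ` X)"
      using ex_is_lub by blast
    then show ?thesis
      using pair_of_lub[OF that] by (metis imageI)
  qed
  then have "bij_betw pair (carrier P) (carrier (Pairs S arrow))"
    using pair_inj pair_carrier unfolding bij_betw_def by (auto intro!: Set.set_eqI)
  moreover have "order_emb P (Pairs S arrow) pair"
    unfolding order_emb_def
    using weak_partial_order_Pairs pair_carrier le_iff_below weak_partial_order_axioms
    by (auto simp: Pairs_simps(2) pair_def)
  ultimately show ?thesis
    unfolding order_iso_def by blast
qed

text \<open>The lattice operations are choice terms, so the first two claims are what gives the
  equation between join and meet its meaning.\<close>

lemma Pairs_inverse: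
  assumes XY: "(X, Y) \<in> carrier (Pairs S arrow)"
  shows "is_lub P (\<Squnion>\<^bsub>P\<^esub> (jn ` X)) (jn ` X)"
    and "is_glb P (\<Sqinter>\<^bsub>P\<^esub> (mt ` Y)) (mt ` Y)"
    and "\<Squnion>\<^bsub>P\<^esub> (jn ` X) = \<Sqinter>\<^bsub>P\<^esub> (mt ` Y)"
    and "inv_into (carrier P) pair (X, Y) = \<Squnion>\<^bsub>P\<^esub> (jn ` X)"
proof -
  have "jn ` X \<subseteq> carrier P"
    using XY[unfolded mem_carrier_Pairs, THEN conjunct1] jn_closed by blast
  then show lub: "is_lub P (\<Squnion>\<^bsub>P\<^esub> (jn ` X)) (jn ` X)"
    using ex_is_lub unfolding sup_def by (auto intro: someI_ex)
  note R = pair_of_lub[OF XY lub]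
  show glb: "is_glb P (\<Sqinter>\<^bsub>P\<^esub> (mt ` Y)) (mt ` Y)"
    using R(3) unfolding inf_def by (auto intro: someI_ex)
  show "\<Squnion>\<^bsub>P\<^esub> (jn ` X) = \<Sqinter>\<^bsub>P\<^esub> (mt ` Y)"
    using greatest_unique[OF R(3) glb] .
  show "inv_into (carrier P) pair (X, Y) = \<Squnion>\<^bsub>P\<^esub> (jn ` X)"
    using inv_into_f_f[OF pair_inj R(2)] R(1) by simp
qed

end

section \<open>Cones cut out by finitely many linear forms\<close>

definition hyp :: "'a::real_inner \<Rightarrow> 'a set" where
  "hyp n = {x. n \<bullet> x = 0}"

definition pos :: "'a::real_inner set \<Rightarrow> 'a \<Rightarrow> 'a set" where
  "pos C x = {k \<in> C. 0 < k \<bullet> x}"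

text \<open>\<open>V\<close> is the whole space for regions and a single hyperplane for shards,
  which allows both to be treated by the same lemmas.\<close>

definition sign_cone :: "'a::real_inner set \<Rightarrow> 'a set \<Rightarrow> 'a set \<Rightarrow> 'a set" where
  "sign_cone V C w = {y \<in> V. \<forall>k\<in>C. if k \<in> w then 0 \<le> k \<bullet> y else k \<bullet> y \<le> 0}"

lemma mem_hyp [simp]: "x \<in> hyp n \<longleftrightarrow> n \<bullet> x = 0"
  by (simp add: hyp_def)

lemma subspace_hyp: "subspace (hyp n)"
  unfolding hyp_def by (rule subspace_hyperplane)

lemma sign_cone_cong:
  "(\<And>k. k \<in> C \<Longrightarrow> k \<in> w \<longleftrightarrow> k \<in> w') \<Longrightarrow> sign_cone V C w = sign_cone V C w'"
  unfolding sign_cone_def by auto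

lemma convex_sign_cone:
  assumes "subspace V"
  shows "convex (sign_cone V C w)"
proof (rule convexI)
  fix x y and u v :: real
  assume xy: "x \<in> sign_cone V C w" "y \<in> sign_cone V C w" and uv: "0 \<le> u" "0 \<le> v" "u + v = 1"
  have "if k \<in> w then 0 \<le> k \<bullet> (u *\<^sub>R x + v *\<^sub>R y) else k \<bullet> (u *\<^sub>R x + v *\<^sub>R y) \<le> 0"
    if "k \<in> C" for k
  proof -
    have "if k \<in> w then 0 \<le> k \<bullet> x \<and> 0 \<le> k \<bullet> y else k \<bullet> x \<le> 0 \<and> k \<bullet> y \<le> 0"
      using xy that unfolding sign_cone_def by fastforce
    then show ?thesis
      using uv by (auto simp: inner_add_right mult_nonneg_nonpos add_nonpos_nonpos split: if_splits)
  qed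
  moreover have "u *\<^sub>R x + v *\<^sub>R y \<in> V"
    using xy assms unfolding sign_cone_def by (simp add: subspace_add subspace_scale)
  ultimately show "u *\<^sub>R x + v *\<^sub>R y \<in> sign_cone V C w"
    unfolding sign_cone_def by blast
qed

lemma eventually_same_sign:
  fixes p v :: "'a::real_inner"
  assumes "finite C"
  shows "\<forall>\<^sub>F t in at_right 0. \<forall>k\<in>C. k \<bullet> p \<noteq> 0 \<longrightarrow> 0 < (k \<bullet> p) * (k \<bullet> (p + t *\<^sub>R v))"
proof (rule eventually_ball_finite[OF assms], rule ballI)
  fix k
  show "\<forall>\<^sub>F t in at_right 0. k \<bullet> p \<noteq> 0 \<longrightarrow> 0 < (k \<bullet> p) * (k \<bullet> (p + t *\<^sub>R v))"
  proof (cases "k \<bullet> p = 0")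
    case False
    have "((\<lambda>t. (k \<bullet> p) * (k \<bullet> (p + t *\<^sub>R v))) \<longlongrightarrow> (k \<bullet> p) * (k \<bullet> (p + 0 *\<^sub>R v))) (at_right 0)"
      by (intro tendsto_intros)
    moreover have "0 < (k \<bullet> p) * (k \<bullet> (p + 0 *\<^sub>R v))"
      using False by (auto simp: zero_less_mult_iff)
    ultimately show ?thesis
      by (auto dest: order_tendstoD(1) elim: eventually_mono)
  qed simp
qed

text \<open>The way to leave a point of a low-dimensional face in a chosen direction: since
  \<open>t > 0\<close>, forms that vanish at \<open>p\<close> take the sign they have at
  \<open>v\<close>, while all others keep their sign by continuity.\<close>

lemma ex_small_step:
  fixes p v :: "'a::real_inner"
  assumes "finite C" "open U" "p \<in> U"
  shows "\<exists>t>0. p + t *\<^sub>R v \<in> U \<and> (\<forall>k\<in>C. k \<bullet> p \<noteq> 0 \<longrightarrow> 0 < (k \<bullet> p) * (k \<bullet> (p + t *\<^sub>R v)))"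
proof -
  have "((\<lambda>t. p + t *\<^sub>R v) \<longlongrightarrow> p + 0 *\<^sub>R v) (at_right 0)"
    by (intro tendsto_intros)
  then have "\<forall>\<^sub>F t in at_right 0. p + t *\<^sub>R v \<in> U"
    using topological_tendstoD[OF _ assms(2)] assms(3) by fastforce
  then have "\<forall>\<^sub>F t in at_right 0. 0 < t \<and> p + t *\<^sub>R v \<in> U \<and>
      (\<forall>k\<in>C. k \<bullet> p \<noteq> 0 \<longrightarrow> 0 < (k \<bullet> p) * (k \<bullet> (p + t *\<^sub>R v)))"
    using eventually_same_sign[OF assms(1), of p v] eventually_at_right_less[of "0::real"]
    by (intro eventually_conj)
  then show ?thesis
    using eventually_happens'[OF trivial_limit_at_right_real] by blast
qed

lemma open_same_sign:
  fixes q :: "'a::real_inner"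
  assumes "finite C"
  shows "open {y. \<forall>k\<in>C. 0 < (k \<bullet> q) * (k \<bullet> y)}"
proof -
  have "{y. \<forall>k\<in>C. 0 < (k \<bullet> q) * (k \<bullet> y)} = (\<Inter>k\<in>C. {y. 0 < (k \<bullet> q) * (k \<bullet> y)})"
    by auto
  moreover have "open {y. 0 < (k \<bullet> q) * (k \<bullet> y)}" for k
    by (intro open_Collect_less continuous_intros)
  ultimately show ?thesis
    using assms by (simp add: open_INT)
qed

text \<open>Forms that vanish identically on \<open>V\<close> cannot be avoided. Any other form is
  made nonzero by a small step along \<open>V\<close>, short enough to stay in \<open>U\<close> and
  to spoil none of the forms already treated.\<close>

lemma generic_nearby:
  fixes V :: "'a::real_inner set"
  assumes "finite C" "subspace V" "open U" "q \<in> U" "q \<in> V"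
  shows "\<exists>q'\<in>V \<inter> U. \<forall>f\<in>C. (\<exists>v\<in>V. f \<bullet> v \<noteq> 0) \<longrightarrow> f \<bullet> q' \<noteq> 0"
  using assms(1)
proof induction
  case empty
  then show ?case using assms by blast
next
  case (insert f C)
  then obtain q' where q': "q' \<in> V" "q' \<in> U" "\<forall>f\<in>C. (\<exists>v\<in>V. f \<bullet> v \<noteq> 0) \<longrightarrow> f \<bullet> q' \<noteq> 0"
    by blast
  show ?case
  proof (cases "f \<bullet> q' = 0 \<and> (\<exists>v\<in>V. f \<bullet> v \<noteq> 0)")
    case True
    then obtain v where v: "v \<in> V" "f \<bullet> v \<noteq> 0"
      by blast
    obtain t where t: "t > 0" "q' + t *\<^sub>R v \<in> U"
      "\<forall>k\<in>C. k \<bullet> q' \<noteq> 0 \<longrightarrow> 0 < (k \<bullet> q') * (k \<bullet> (q' + t *\<^sub>R v))"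
      using ex_small_step[OF insert.hyps(1) assms(3) q'(2)] by blast
    have "f \<bullet> (q' + t *\<^sub>R v) \<noteq> 0"
      using True v t by (simp add: inner_add_right)
    moreover have "q' + t *\<^sub>R v \<in> V"
      using q' v assms(2) by (simp add: subspace_add subspace_scale)
    moreover have "k \<bullet> (q' + t *\<^sub>R v) \<noteq> 0" if "k \<in> C" "\<exists>v\<in>V. k \<bullet> v \<noteq> 0" for k
      using t(3) q'(3) that by fastforce
    ultimately show ?thesis
      using t(2) by blast
  qed (use q' in blast)
qed

section \<open>Components of complements and their closures\<close>

lemma connected_component_complement:
  fixes V :: "'a::real_inner set"
  assumes V: "subspace V" and x: "x \<in> V" "\<forall>k\<in>C. k \<bullet> x \<noteq> 0"
  shows "connected_component_set (V - (\<Union>k\<in>C. hyp k)) x = {y \<in> V. \<forall>k\<in>C. 0 < (k \<bullet> x) * (k \<bullet> y)}"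
    (is "?L = ?R")
proof
  have "convex ?R"
  proof (rule convexI)
    fix y z and u v :: real
    assume yz: "y \<in> ?R" "z \<in> ?R" and uv: "0 \<le> u" "0 \<le> v" "u + v = 1"
    have "0 < (k \<bullet> x) * (k \<bullet> (u *\<^sub>R y + v *\<^sub>R z))" if "k \<in> C" for k
    proof -
      have "0 < (k \<bullet> x) * (k \<bullet> y)" "0 < (k \<bullet> x) * (k \<bullet> z)"
        using yz that by auto
      then have "0 < u * ((k \<bullet> x) * (k \<bullet> y)) + v * ((k \<bullet> x) * (k \<bullet> z))"
        using uv by (cases "u = 0") (auto simp: add_pos_nonneg)
      then show ?thesis
        by (simp add: inner_add_right algebra_simps)
    qed
    then show "u *\<^sub>R y + v *\<^sub>R z \<in> ?R"
      using yz V by (simp add: subspace_add subspace_scale)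
  qed
  then show "?R \<subseteq> ?L"
    using x by (intro connected_component_maximal) (auto simp: convex_connected zero_less_mult_iff)
  show "?L \<subseteq> ?R"
  proof
    fix y
    assume "y \<in> ?L"
    then obtain T where T: "connected T" "T \<subseteq> V - (\<Union>k\<in>C. hyp k)" "x \<in> T" "y \<in> T"
      unfolding connected_component_def by auto
    have "0 < (k \<bullet> x) * (k \<bullet> y)" if k: "k \<in> C" for k
    proof -
      have "open {z. 0 < k \<bullet> z}" "open {z. k \<bullet> z < 0}"
        by (intro open_Collect_less continuous_intros)+
      moreover have "T \<subseteq> {z. 0 < k \<bullet> z} \<union> {z. k \<bullet> z < 0}"
        using T(2) k by fastforce
      ultimately have "{z. 0 < k \<bullet> z} \<inter> T = {} \<or> {z. k \<bullet> z < 0} \<inter> T = {}"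
        using T(1) by (intro connectedD) auto
      moreover have "k \<bullet> x \<noteq> 0" "k \<bullet> y \<noteq> 0"
        using T k by auto
      ultimately show ?thesis
        using T(3,4) by (auto simp: zero_less_mult_iff disjoint_iff not_less order_le_less)
    qed
    then show "y \<in> ?R"
      using T by auto
  qed
qed

text \<open>Adding a positive multiple of the interior point \<open>x\<close> turns all weak
  inequalities at \<open>y\<close> into strict ones, so \<open>y\<close> is a limit of points of the
  open cell.\<close>

lemma closure_sign_cell:
  fixes V :: "'a::euclidean_space set"
  assumes V: "subspace V" and x: "x \<in> V" "\<forall>k\<in>C. k \<bullet> x \<noteq> 0"
  shows "closure {y \<in> V. \<forall>k\<in>C. 0 < (k \<bullet> x) * (k \<bullet> y)} = sign_cone V C (pos C x)"
    (is "closure ?R = ?S")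
proof
  have "(if k \<in> pos C x then 0 \<le> k \<bullet> y else k \<bullet> y \<le> 0) \<longleftrightarrow> 0 \<le> (k \<bullet> x) * (k \<bullet> y)" if "k \<in> C" for k y
    using x(2) that unfolding pos_def by (cases "0 < k \<bullet> x") (force simp: zero_le_mult_iff)+
  then have eq: "?S = V \<inter> (\<Inter>k\<in>C. {y. 0 \<le> (k \<bullet> x) * (k \<bullet> y)})"
    unfolding sign_cone_def by auto
  have "closed ?S"
    unfolding eq by (intro closed_Int closed_INT ballI closed_subspace V closed_Collect_le continuous_intros)
  moreover have "?R \<subseteq> ?S"
    unfolding eq by (auto simp: less_imp_le)
  ultimately show "closure ?R \<subseteq> ?S"
    by (rule closure_minimal[rotated])
  show "?S \<subseteq> closure ?R"
  proof
    fix y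
    assume y: "y \<in> ?S"
    have step: "y + t *\<^sub>R x \<in> closure ?R" if "0 < t" for t
    proof -
      have "0 < (k \<bullet> x) * (k \<bullet> (y + t *\<^sub>R x))" if "k \<in> C" for k
      proof -
        have "0 \<le> (k \<bullet> x) * (k \<bullet> y)" "0 < t * ((k \<bullet> x) * (k \<bullet> x))"
          using y x that \<open>0 < t\<close> unfolding eq by (auto simp: zero_less_mult_iff)
        then show ?thesis
          by (simp add: inner_add_right algebra_simps)
      qed
      then have "y + t *\<^sub>R x \<in> ?R"
        using x y V unfolding eq by (simp add: subspace_add subspace_scale)
      then show ?thesis
        by (rule subsetD[OF closure_subset])
    qed
    have "\<forall>\<^sub>F t in at_right 0. y + t *\<^sub>R x \<in> closure ?R"
      by (rule eventually_mono[OF eventually_at_right_less[of "0::real"]]) (rule step)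
    moreover have "((\<lambda>t. y + t *\<^sub>R x) \<longlongrightarrow> y + 0 *\<^sub>R x) (at_right 0)"
      by (intro tendsto_intros)
    ultimately have "y + 0 *\<^sub>R x \<in> closure ?R"
      by (intro Lim_in_closed_set[OF closed_closure _ trivial_limit_at_right_real])
    then show "y \<in> closure ?R"
      by simp
  qed
qed

lemma closure_components_complement:
  fixes V :: "'a::euclidean_space set"
  assumes "subspace V"
  shows "closure ` components (V - (\<Union>k\<in>C. hyp k)) =
    (\<lambda>x. sign_cone V C (pos C x)) ` {x \<in> V. \<forall>k\<in>C. k \<bullet> x \<noteq> 0}"
proof -
  have "V - (\<Union>k\<in>C. hyp k) = {x \<in> V. \<forall>k\<in>C. k \<bullet> x \<noteq> 0}"
    by auto
  then have "components (V - (\<Union>k\<in>C. hyp k)) =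
      connected_component_set (V - (\<Union>k\<in>C. hyp k)) ` {x \<in> V. \<forall>k\<in>C. k \<bullet> x \<noteq> 0}"
    unfolding components_def by simp
  then show ?thesis
    using closure_sign_cell[OF assms] connected_component_complement[OF assms]
    by (auto simp: image_image intro!: image_cong)
qed

text \<open>Trades a dimension hypothesis for a point, since the relative interior of
  \<open>Z\<close> is open in \<open>V\<close>; \<open>full_dim_of_open\<close> is the way
  back.\<close>

lemma generic_point_of_full_dim:
  fixes V :: "'a::euclidean_space set"
  assumes V: "subspace V" and Z: "convex Z" "Z \<subseteq> V" "aff_dim Z = int (dim V)" and C: "finite C"
  shows "\<exists>q\<in>Z. \<forall>f\<in>C. (\<exists>v\<in>V. f \<bullet> v \<noteq> 0) \<longrightarrow> f \<bullet> q \<noteq> 0"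
proof -
  have "Z \<noteq> {}"
    using Z(3) by auto
  then obtain q where q: "q \<in> rel_interior Z"
    using Z(1) rel_interior_eq_empty by blast
  have "affine hull Z = V"
    using Z V \<open>Z \<noteq> {}\<close>
    by (intro affine_dim_equal) (auto simp: subspace_imp_affine hull_minimal aff_dim_subspace)
  then obtain U where U: "open U" "q \<in> U" "q \<in> Z" "U \<inter> V \<subseteq> Z"
    using q mem_rel_interior by blast
  then show ?thesis
    using generic_nearby[OF C V U(1,2)] Z(2) by blast
qed

lemma full_dim_of_open:
  fixes V :: "'a::euclidean_space set"
  assumes "subspace V" "Z \<subseteq> V" "open U" "q \<in> U" "q \<in> V" "U \<inter> V \<subseteq> Z"
  shows "aff_dim Z = int (dim V)"
proof -
  have "aff_dim (V \<inter> U) = aff_dim V"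
    using assms by (intro aff_dim_openin openin_open_Int) (auto simp: subspace_imp_affine)
  moreover have "aff_dim (V \<inter> U) \<le> aff_dim Z" "aff_dim Z \<le> aff_dim V"
    using assms by (auto intro: aff_dim_subset)
  ultimately show ?thesis
    using assms(1) by (simp add: aff_dim_subspace)
qed

lemma in_span_of_orthogonal:
  fixes u :: "'a::euclidean_space"
  assumes "\<And>v. (\<forall>s\<in>S. s \<bullet> v = 0) \<Longrightarrow> u \<bullet> v = 0"
  shows "u \<in> span S"
proof -
  have "u \<in> orthogonal_comp (orthogonal_comp (span S))"
    unfolding orthogonal_comp_def
    using assms by (auto simp: orthogonal_def inner_commute intro: span_base)
  then show ?thesis
    by (simp add: orthogonal_comp_self)
qed

text \<open>The end point \<open>q'\<close> is perturbed so that the segment from \<open>q\<close> to it meets two of the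
  hyperplanes at the same time only if they have the same trace on \<open>V\<close>.\<close>

lemma gallery_step:
  fixes V :: "'a::real_inner set"
  assumes V: "subspace V" and C: "finite C"
    and q: "q \<in> V" "\<forall>k\<in>C. k \<bullet> q \<noteq> 0" and q': "q' \<in> V" "\<forall>k\<in>C. k \<bullet> q' \<noteq> 0"
    and neq: "pos C q \<noteq> pos C q'"
  shows "\<exists>r\<in>V. \<exists>k\<^sub>0\<in>sym_diff (pos C q) (pos C q'). (\<forall>k\<in>C. k \<bullet> r \<noteq> 0) \<and>
    sym_diff (pos C q) (pos C r) \<subseteq> sym_diff (pos C q) (pos C q') \<and>
    (\<forall>k\<in>C. k \<in> sym_diff (pos C q) (pos C r) \<longleftrightarrow> (\<exists>c. \<forall>v\<in>V. k \<bullet> v = c * (k\<^sub>0 \<bullet> v)))"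
proof -
  \<comment> \<open>The form of the pair \<open>(k, l)\<close> vanishes on \<open>V\<close> iff
    \<open>k\<close> and \<open>l\<close> are proportional there. If the segment from
    \<open>q\<close> to \<open>p\<close> crosses both hyperplanes, the form vanishes at
    \<open>p\<close> iff they are crossed at the same parameter.\<close>
  define F where "F = (\<lambda>(k, l). (k \<bullet> q) *\<^sub>R l - (l \<bullet> q) *\<^sub>R k) ` (C \<times> C)"
  have "finite F"
    using C unfolding F_def by blast
  moreover have "q' \<in> {y. \<forall>k\<in>C. 0 < (k \<bullet> q') * (k \<bullet> y)}"
    using q' by (auto simp: zero_less_mult_iff)
  ultimately obtain p where p: "p \<in> V" "\<forall>k\<in>C. 0 < (k \<bullet> q') * (k \<bullet> p)"
    and gen: "\<forall>f\<in>F. (\<exists>v\<in>V. f \<bullet> v \<noteq> 0) \<longrightarrow> f \<bullet> p \<noteq> 0"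
    using generic_nearby[OF _ V open_same_sign[OF C]] q'(1) by blast
  have gen': "(k \<bullet> q) * (l \<bullet> v) = (l \<bullet> q) * (k \<bullet> v)"
    if "k \<in> C" "l \<in> C" "(k \<bullet> q) * (l \<bullet> p) = (l \<bullet> q) * (k \<bullet> p)" "v \<in> V" for k l v
  proof -
    have "(k \<bullet> q) *\<^sub>R l - (l \<bullet> q) *\<^sub>R k \<in> F"
      using that(1,2) unfolding F_def by force
    moreover have "((k \<bullet> q) *\<^sub>R l - (l \<bullet> q) *\<^sub>R k) \<bullet> p = 0"
      using that(3) by (simp add: inner_diff_left)
    ultimately have "((k \<bullet> q) *\<^sub>R l - (l \<bullet> q) *\<^sub>R k) \<bullet> v = 0"
      using gen that(4) by blast
    then show ?thesis
      by (simp add: inner_diff_left)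
  qed
  define D where "D = {k \<in> C. (k \<bullet> q) * (k \<bullet> p) < 0}"
  have D: "sym_diff (pos C q) (pos C q') = D"
    using q(2) p(2) unfolding pos_def D_def by (fastforce simp: zero_less_mult_iff mult_less_0_iff)
  \<comment> \<open>The parameter at which the segment from \<open>q\<close> to \<open>p\<close>
    meets the hyperplane of \<open>k\<close>; \<open>k\<^sub>0\<close> is one met earliest, and
    \<open>z\<close> is the point where this happens.\<close>
  define \<tau> where "\<tau> k = (k \<bullet> q) / (k \<bullet> q - k \<bullet> p)" for k
  have "finite D" "D \<noteq> {}"
    using C neq D unfolding D_def by auto
  then obtain k\<^sub>0 where k0: "k\<^sub>0 \<in> D" "\<And>k. k \<in> D \<Longrightarrow> \<tau> k\<^sub>0 \<le> \<tau> k"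
    using ex_is_arg_min_if_finite[of D \<tau>] unfolding is_arg_min_linorder by blast
  have tau: "0 < \<tau> k \<and> \<tau> k < 1" if "k \<in> D" for k
    using that unfolding D_def \<tau>_def by (auto simp: mult_less_0_iff divide_simps)
  define z where "z = q + \<tau> k\<^sub>0 *\<^sub>R (p - q)"
  have zV: "z \<in> V"
    using q p V unfolding z_def by (simp add: subspace_add subspace_scale subspace_diff)
  have z: "k \<bullet> z = (1 - \<tau> k\<^sub>0) * (k \<bullet> q) + \<tau> k\<^sub>0 * (k \<bullet> p)" for k
    unfolding z_def by (simp add: inner_add_right inner_diff_right algebra_simps)
  define par where "par k \<longleftrightarrow> (\<exists>c. \<forall>v\<in>V. k \<bullet> v = c * (k\<^sub>0 \<bullet> v))" for k
  have k0C: "k\<^sub>0 \<in> C" "k\<^sub>0 \<bullet> q \<noteq> 0" "(k\<^sub>0 \<bullet> q) * (k\<^sub>0 \<bullet> p) < 0"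
    using k0 unfolding D_def by auto
  have z0: "k\<^sub>0 \<bullet> z = 0"
    using k0C unfolding z \<tau>_def by (auto simp: mult_less_0_iff field_simps)
  have 1: "k \<in> D \<and> k \<bullet> z = 0" if k: "k \<in> C" "par k" for k
  proof -
    obtain c where c: "\<forall>v\<in>V. k \<bullet> v = c * (k\<^sub>0 \<bullet> v)"
      using k(2) unfolding par_def by blast
    have "c \<noteq> 0"
      using c q k(1) by fastforce
    have "(k \<bullet> q) * (k \<bullet> p) = c\<^sup>2 * ((k\<^sub>0 \<bullet> q) * (k\<^sub>0 \<bullet> p))"
      using c q(1) p(1) by (simp add: power2_eq_square)
    also have "\<dots> < 0"
      using k0C(3) \<open>c \<noteq> 0\<close> by (simp add: mult_pos_neg)
    finally show ?thesis
      using c zV z0 k(1) unfolding D_def by simp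
  qed
  \<comment> \<open>By genericity of \<open>p\<close>, all hyperplanes with a different trace on
    \<open>V\<close> are met later than \<open>z\<close> or not at all, so \<open>q\<close> and
    \<open>z\<close> lie strictly on the same side of them.\<close>
  have 2: "0 < (k \<bullet> q) * (k \<bullet> z)" if k: "k \<in> C" "\<not> par k" for k
  proof (cases "k \<in> D")
    case False
    have "0 < (k \<bullet> q) * (k \<bullet> p)"
      using False k(1) q(2) p(2) unfolding D_def by (fastforce simp: not_less order_le_less)
    moreover have "0 < (k \<bullet> q) * (k \<bullet> q)"
      using q(2) k(1) by (metis not_real_square_gt_zero)
    ultimately have "0 < (1 - \<tau> k\<^sub>0) * ((k \<bullet> q) * (k \<bullet> q)) + \<tau> k\<^sub>0 * ((k \<bullet> q) * (k \<bullet> p))"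
      using tau[OF k0(1)] by (simp add: add_pos_pos)
    then show ?thesis
      unfolding z by (simp add: algebra_simps)
  next
    case True
    then have kD: "(k \<bullet> q) * (k \<bullet> p) < 0"
      unfolding D_def by blast
    then have nz: "k \<bullet> q - k \<bullet> p \<noteq> 0"
      by (auto simp: mult_less_0_iff)
    have "\<tau> k\<^sub>0 \<noteq> \<tau> k"
    proof
      assume "\<tau> k\<^sub>0 = \<tau> k"
      moreover have "k\<^sub>0 \<bullet> q - k\<^sub>0 \<bullet> p \<noteq> 0"
        using k0C(3) by (auto simp: mult_less_0_iff)
      ultimately have "(k\<^sub>0 \<bullet> q) * (k \<bullet> p) = (k \<bullet> q) * (k\<^sub>0 \<bullet> p)"
        using nz unfolding \<tau>_def by (simp add: frac_eq_eq algebra_simps)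
      then have "(k\<^sub>0 \<bullet> q) * (k \<bullet> v) = (k \<bullet> q) * (k\<^sub>0 \<bullet> v)" if "v \<in> V" for v
        using gen' k0C(1) k(1) that by blast
      then have "\<forall>v\<in>V. k \<bullet> v = ((k \<bullet> q) / (k\<^sub>0 \<bullet> q)) * (k\<^sub>0 \<bullet> v)"
        using k0C(2) by (simp add: field_simps)
      then show False
        using k(2) unfolding par_def by blast
    qed
    then have "\<tau> k\<^sub>0 < \<tau> k"
      using k0(2)[OF True] by simp
    moreover have "k \<bullet> z = (k \<bullet> q - k \<bullet> p) * (\<tau> k - \<tau> k\<^sub>0)"
      using nz unfolding z by (simp add: \<tau>_def[of k] right_diff_distrib) (simp add: algebra_simps)
    moreover have "0 < (k \<bullet> q) * (k \<bullet> q - k \<bullet> p)"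
      using kD by (auto simp: mult_less_0_iff zero_less_mult_iff)
    ultimately show ?thesis
      by (simp add: mult.assoc[symmetric])
  qed
  obtain t where t: "t > 0" "\<forall>k\<in>C. k \<bullet> z \<noteq> 0 \<longrightarrow> 0 < (k \<bullet> z) * (k \<bullet> (z + t *\<^sub>R (z - q)))"
    using ex_small_step[OF C open_UNIV, of z] by blast
  \<comment> \<open>A point just beyond \<open>z\<close> on the ray from \<open>q\<close>: forms
    vanishing at \<open>z\<close> take the value \<open>- t * (k \<bullet> q)\<close> and change
    sign, the others keep theirs.\<close>
  define r where "r = z + t *\<^sub>R (z - q)"
  have rV: "r \<in> V"
    using zV q V unfolding r_def by (simp add: subspace_add subspace_scale subspace_diff)
  have r1: "(k \<bullet> q) * (k \<bullet> r) < 0" if "k \<in> C" "par k" for k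
  proof -
    have "k \<bullet> r = - t * (k \<bullet> q)"
      using 1[OF that] unfolding r_def by (simp add: inner_add_right inner_diff_right)
    moreover have "0 < t * ((k \<bullet> q) * (k \<bullet> q))"
      using t(1) q(2) that(1) by (metis mult_pos_pos not_real_square_gt_zero)
    ultimately show ?thesis
      by (simp add: algebra_simps)
  qed
  have r2: "0 < (k \<bullet> q) * (k \<bullet> r)" if "k \<in> C" "\<not> par k" for k
    using 2[OF that] t(2) that(1) unfolding r_def[symmetric] by (fastforce simp: zero_less_mult_iff)
  have nz: "\<forall>k\<in>C. k \<bullet> r \<noteq> 0"
    using r1 r2 by fastforce
  have sd: "k \<in> sym_diff (pos C q) (pos C r) \<longleftrightarrow> par k" if "k \<in> C" for k
    using r1[OF that] r2[OF that] that unfolding pos_def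
    by (cases "par k") (auto simp: zero_less_mult_iff mult_less_0_iff)
  have "sym_diff (pos C q) (pos C r) \<subseteq> D"
  proof
    fix k
    assume k: "k \<in> sym_diff (pos C q) (pos C r)"
    then have "k \<in> C"
      unfolding pos_def by blast
    then show "k \<in> D"
      using sd 1 k by blast
  qed
  then show ?thesis
    using rV k0(1) nz sd unfolding D par_def by blast
qed

section \<open>Normalised systems of normal vectors\<close>

text \<open>Every hyperplane is represented by the normal vector whose value at a fixed interior point
  \<open>b\<close> of the base region is \<open>-1\<close>. All normal vectors then lie in one affine hyperplane, the
  rank-two subarrangement of \<open>k\<close> and \<open>n\<close> consists of the normal vectors on a line, and its
  basic members are the two extreme points on that line.\<close>

locale normal_system =
  fixes N :: "'a::euclidean_space set" and b :: 'a
  assumes finite_N: "finite N" and normalised: "n \<in> N \<Longrightarrow> n \<bullet> b = -1"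
begin

text \<open>Normals are negative at \<open>b\<close>, so the positive ones at a generic point are
  those whose hyperplanes separate it from \<open>b\<close>: regions are encoded by separating sets,
  and the base region by \<open>{}\<close>.\<close>

definition chambers :: "'a set set" where
  "chambers = pos N ` {x. \<forall>n\<in>N. n \<bullet> x \<noteq> 0}"

definition line :: "'a \<Rightarrow> 'a \<Rightarrow> 'a set" where
  "line k n = N \<inter> affine hull {k, n}"

definition extreme :: "'a \<Rightarrow> 'a \<Rightarrow> bool" where
  "extreme k n \<longleftrightarrow> (\<forall>x\<in>line k n. \<forall>y\<in>line k n. k \<notin> open_segment x y)"

definition cutter :: "'a \<Rightarrow> 'a \<Rightarrow> bool" where
  "cutter k n \<longleftrightarrow> k \<in> N \<and> n \<in> N \<and> k \<noteq> n \<and> extreme k n \<and> \<not> extreme n k"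

section \<open>Chambers and their walls\<close>

lemma nonzero: "n \<in> N \<Longrightarrow> n \<noteq> 0"
  using normalised by force

lemma chambersI: "\<forall>n\<in>N. n \<bullet> x \<noteq> 0 \<Longrightarrow> pos N x \<in> chambers"
  unfolding chambers_def by blast

lemma chambersE:
  assumes "w \<in> chambers"
  obtains x where "\<forall>n\<in>N. n \<bullet> x \<noteq> 0" "w = pos N x"
  using assms unfolding chambers_def by blast

lemma chambers_subset: "w \<in> chambers \<Longrightarrow> w \<subseteq> N"
  unfolding chambers_def pos_def by blast

lemma pos_b: "pos N b = {}"
  unfolding pos_def using normalised by fastforce

lemma empty_chamber: "{} \<in> chambers"
  using chambersI[of b] normalised pos_b by fastforce

lemma compl_chamber:
  assumes "w \<in> chambers"
  shows "N - w \<in> chambers"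
proof -
  obtain x where x: "\<forall>n\<in>N. n \<bullet> x \<noteq> 0" "w = pos N x"
    using assms by (rule chambersE)
  have "pos N (- x) = N - w"
    using x unfolding pos_def by (auto simp: not_less order_le_less)
  then show ?thesis
    using chambersI[of "- x"] x(1) by simp
qed

lemma eq_of_scaled:
  assumes "k \<in> N" "n \<in> N" "k = c *\<^sub>R n"
  shows "k = n"
proof -
  have "k \<bullet> b = c * (n \<bullet> b)"
    using assms(3) by simp
  then have "c = 1"
    using normalised[OF assms(1)] normalised[OF assms(2)] by simp
  then show ?thesis
    using assms(3) by simp
qed

text \<open>Evaluation at \<open>b\<close> forces the two coefficients to sum to
  \<open>1\<close>.\<close>

lemma affine_of_span:
  assumes "m \<in> N" "k \<in> N" "n \<in> N" "m \<in> span {k, n}"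
  shows "m \<in> affine hull {k, n}"
proof -
  obtain c d where m: "m = c *\<^sub>R k + d *\<^sub>R n"
    using assms(4) by (auto simp: span_insert algebra_simps)
  have "m \<bullet> b = c * (k \<bullet> b) + d * (n \<bullet> b)"
    unfolding m by (simp add: inner_add_left)
  then have "c + d = 1"
    using assms normalised by simp
  then show ?thesis
    using m unfolding affine_hull_2 by blast
qed

text \<open>A gallery step in the whole space crosses exactly the normals proportional to
  \<open>k\<close>, and the normalisation leaves only \<open>k\<close> itself.\<close>

lemma chain_chambers:
  assumes "w \<in> chambers" "w' \<in> chambers" "w \<subset> w'"
  shows "\<exists>k\<in>w' - w. insert k w \<in> chambers"
proof -
  obtain q q' where q: "\<forall>n\<in>N. n \<bullet> q \<noteq> 0" "w = pos N q" "\<forall>n\<in>N. n \<bullet> q' \<noteq> 0" "w' = pos N q'"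
    using assms by (meson chambersE)
  obtain r k where r: "k \<in> sym_diff w w'" "\<forall>n\<in>N. n \<bullet> r \<noteq> 0" and
    sd: "\<forall>m\<in>N. m \<in> sym_diff w (pos N r) \<longleftrightarrow> (\<exists>c. \<forall>v\<in>UNIV. m \<bullet> v = c * (k \<bullet> v))"
    using gallery_step[OF subspace_UNIV finite_N, of q q'] q assms(3) by blast
  have k: "k \<in> w' - w"
    using r(1) assms(3) by blast
  then have kN: "k \<in> N"
    using chambers_subset assms by blast
  have "m = k" if "m \<in> N" "\<forall>v\<in>UNIV. m \<bullet> v = c * (k \<bullet> v)" for m c
  proof -
    have "(m - c *\<^sub>R k) \<bullet> (m - c *\<^sub>R k) = 0"
      using that(2) by (simp add: inner_diff_left)
    then have "m = c *\<^sub>R k"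
      by simp
    then show ?thesis
      using eq_of_scaled[OF that(1) kN] by blast
  qed
  moreover have "\<forall>v\<in>UNIV. k \<bullet> v = 1 * (k \<bullet> v)"
    by simp
  ultimately have "m \<in> sym_diff w (pos N r) \<longleftrightarrow> m = k" if "m \<in> N" for m
    using sd that by blast
  then have "pos N r = insert k w"
    using k kN chambers_subset[OF assms(1)] chambers_subset[OF assms(2)] unfolding pos_def by blast
  then show ?thesis
    using k chambersI[OF r(2)] by metis
qed

text \<open>Represents a wall by a point lying on the hyperplane of \<open>n\<close> and on no
  other. As \<open>pos\<close> is strict, that point carries the sign set of the lower side.
  Conversely, small steps from it along \<open>n\<close> and \<open>- n\<close> reach the two
  adjacent regions.\<close>

lemma cover_edge_iff:
  "cover_edge chambers a n \<longleftrightarrow>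
    n \<in> N \<and> (\<exists>q. n \<bullet> q = 0 \<and> (\<forall>m\<in>N - {n}. m \<bullet> q \<noteq> 0) \<and> pos N q = a)"
proof
  assume e: "cover_edge chambers a n"
  then obtain x y where x: "\<forall>m\<in>N. m \<bullet> x \<noteq> 0" "a = pos N x"
    and y: "\<forall>m\<in>N. m \<bullet> y \<noteq> 0" "insert n a = pos N y" and na: "n \<notin> a"
    unfolding cover_edge_def by (meson chambersE)
  have n: "n \<in> N" "n \<bullet> x < 0" "0 < n \<bullet> y"
    using x y na unfolding pos_def by (auto simp: not_less order_le_less)
  have sgn: "0 < (m \<bullet> x) * (m \<bullet> y)" if "m \<in> N - {n}" for m
  proof -
    have "0 < m \<bullet> x \<longleftrightarrow> 0 < m \<bullet> y" "m \<bullet> x \<noteq> 0" "m \<bullet> y \<noteq> 0"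
      using x y that unfolding pos_def by blast+
    then show ?thesis
      by (cases "0 < m \<bullet> x") (auto simp: zero_less_mult_iff)
  qed
  \<comment> \<open>Chosen so that \<open>n\<close> vanishes at the convex combination
    \<open>q\<close> of \<open>x\<close> and \<open>y\<close>.\<close>
  define s where "s = (n \<bullet> y) / (n \<bullet> y - n \<bullet> x)"
  have s: "0 < s" "s < 1"
    using n unfolding s_def by auto
  define q where "q = s *\<^sub>R x + (1 - s) *\<^sub>R y"
  have mq: "m \<bullet> q = s * (m \<bullet> x) + (1 - s) * (m \<bullet> y)" for m
    unfolding q_def by (simp add: inner_add_right)
  have "n \<bullet> q = 0"
    using n unfolding mq s_def by (simp add: field_simps)
  moreover have pq: "0 < (m \<bullet> x) * (m \<bullet> q)" if "m \<in> N - {n}" for m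
  proof -
    have "0 < (m \<bullet> x) * (m \<bullet> x)"
      using x(1) that by (metis DiffD1 not_real_square_gt_zero)
    then have "0 < s * ((m \<bullet> x) * (m \<bullet> x)) + (1 - s) * ((m \<bullet> x) * (m \<bullet> y))"
      using s sgn[OF that] by (simp add: add_pos_pos)
    then show ?thesis
      unfolding mq by (simp add: algebra_simps)
  qed
  moreover have "pos N q = a"
  proof -
    have "m \<in> pos N q \<longleftrightarrow> m \<in> a" if "m \<in> N" for m
      using pq[of m] that \<open>n \<bullet> q = 0\<close> na unfolding x(2) pos_def
      by (cases "m = n") (auto simp: zero_less_mult_iff)
    then show ?thesis
      unfolding x(2) pos_def by blast
  qed
  ultimately show "n \<in> N \<and> (\<exists>q. n \<bullet> q = 0 \<and> (\<forall>m\<in>N - {n}. m \<bullet> q \<noteq> 0) \<and> pos N q = a)"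
    using n(1) by fastforce
next
  assume "n \<in> N \<and> (\<exists>q. n \<bullet> q = 0 \<and> (\<forall>m\<in>N - {n}. m \<bullet> q \<noteq> 0) \<and> pos N q = a)"
  then obtain q where q: "n \<in> N" "n \<bullet> q = 0" "\<forall>m\<in>N - {n}. m \<bullet> q \<noteq> 0" "pos N q = a"
    by blast
  have nn: "0 < n \<bullet> n"
    using nonzero q(1) by simp
  have "\<exists>x. (\<forall>m\<in>N. m \<bullet> x \<noteq> 0) \<and> 0 < c * (n \<bullet> x) \<and> (\<forall>m\<in>N - {n}. 0 < m \<bullet> x \<longleftrightarrow> 0 < m \<bullet> q)"
    if c: "c = 1 \<or> c = -1" for c :: real
  proof -
    obtain t where t: "t > 0" "\<forall>m\<in>N. m \<bullet> q \<noteq> 0 \<longrightarrow> 0 < (m \<bullet> q) * (m \<bullet> (q + t *\<^sub>R (c *\<^sub>R n)))"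
      using ex_small_step[OF finite_N open_UNIV, of q "c *\<^sub>R n"] by blast
    have "0 < c * (n \<bullet> (q + t *\<^sub>R (c *\<^sub>R n)))"
      using t(1) q(2) nn c by (auto simp: inner_add_right)
    moreover have "0 < m \<bullet> (q + t *\<^sub>R (c *\<^sub>R n)) \<longleftrightarrow> 0 < m \<bullet> q" "m \<bullet> (q + t *\<^sub>R (c *\<^sub>R n)) \<noteq> 0"
      if "m \<in> N - {n}" for m
      using t(2) q(3) that by (fastforce simp: zero_less_mult_iff)+
    ultimately show ?thesis
      by (metis DiffI mult_zero_right order_less_irrefl singletonD)
  qed
  from this[of 1] this[of "-1"] obtain x y where
    x: "\<forall>m\<in>N. m \<bullet> x \<noteq> 0" "0 < n \<bullet> x" "\<forall>m\<in>N - {n}. 0 < m \<bullet> x \<longleftrightarrow> 0 < m \<bullet> q" and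
    y: "\<forall>m\<in>N. m \<bullet> y \<noteq> 0" "n \<bullet> y < 0" "\<forall>m\<in>N - {n}. 0 < m \<bullet> y \<longleftrightarrow> 0 < m \<bullet> q"
    by auto
  have "pos N x = insert n a"
    using x q unfolding pos_def by auto
  moreover have "pos N y = a"
    using y q unfolding pos_def by force
  moreover have "n \<notin> a"
    using q unfolding pos_def by auto
  ultimately show "cover_edge chambers a n"
    unfolding cover_edge_def using chambersI[OF x(1)] chambersI[OF y(1)] by simp
qed

section \<open>Rank-two subarrangements as lines of normals\<close>

lemma line_commute: "line k n = line n k"
  unfolding line_def by (simp add: insert_commute)

lemma mem_line: "k \<in> N \<Longrightarrow> n \<in> N \<Longrightarrow> k \<in> line k n \<and> n \<in> line k n"
  unfolding line_def by (simp add: hull_inc)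

lemma line_eq:
  assumes "m \<in> line k n" "m \<noteq> k"
  shows "line k m = line k n"
proof -
  obtain s where m: "m = k + s *\<^sub>R (n - k)"
    using assms(1) unfolding line_def affine_hull_2_alt by auto
  have s: "s \<noteq> 0"
    using m assms(2) by auto
  have "k + u *\<^sub>R (m - k) \<in> affine hull {k, n}" for u
    unfolding affine_hull_2_alt m by auto
  moreover have "k + u *\<^sub>R (n - k) \<in> affine hull {k, m}" for u
  proof -
    have "k + u *\<^sub>R (n - k) = k + (u / s) *\<^sub>R (m - k)"
      using s unfolding m by simp
    then show ?thesis
      unfolding affine_hull_2_alt by blast
  qed
  ultimately have "affine hull {k, m} = affine hull {k, n}"
    unfolding affine_hull_2_alt by auto
  then show ?thesis
    unfolding line_def by simp
qed

lemma extreme_cong: "m \<in> line k n \<Longrightarrow> m \<noteq> k \<Longrightarrow> extreme k m \<longleftrightarrow> extreme k n"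
  unfolding extreme_def by (simp add: line_eq)

lemma finite_line: "finite (line k n)"
  unfolding line_def using finite_N by simp

text \<open>By duality, containing the codimension-two intersection means lying in the span of the
  two normals, and by normalisation on their line; so lines of normals are rank-two
  subarrangements.\<close>

lemma mem_line_iff:
  assumes "m \<in> N" "k \<in> N" "n \<in> N"
  shows "m \<in> line k n \<longleftrightarrow> hyp k \<inter> hyp n \<subseteq> hyp m"
proof
  assume "m \<in> line k n"
  then show "hyp k \<inter> hyp n \<subseteq> hyp m"
    unfolding line_def affine_hull_2 by (auto simp: inner_add_left)
next
  assume "hyp k \<inter> hyp n \<subseteq> hyp m"
  then have "m \<in> span {k, n}"
    by (intro in_span_of_orthogonal) auto
  then show "m \<in> line k n"
    using affine_of_span assms unfolding line_def by blast
qed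

lemma hyp_inj:
  assumes "m \<in> N" "n \<in> N" "hyp n \<subseteq> hyp m"
  shows "m = n"
proof -
  have "m \<in> span {n}"
    using assms(3) by (intro in_span_of_orthogonal) auto
  then show ?thesis
    using eq_of_scaled assms by (auto simp: span_singleton)
qed

text \<open>The convex hull of the finitely many normals on the line is compact and therefore has an
  extreme point. It is one of these normals, differs from \<open>n\<close>, and hence cuts
  \<open>n\<close>.\<close>

lemma ex_extreme_cutter:
  assumes "n \<in> N" "m \<in> N" "\<not> extreme n m"
  shows "\<exists>k\<in>line n m. cutter k n"
proof -
  let ?T = "line n m"
  obtain x y where xy: "x \<in> ?T" "y \<in> ?T" "n \<in> open_segment x y"
    using assms(3) unfolding extreme_def by blast
  have "convex hull ?T \<noteq> {}" "compact (convex hull ?T)"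
    using xy(1) finite_line by (auto intro: finite_imp_compact_convex_hull)
  then obtain k where k: "k extreme_point_of (convex hull ?T)"
    using extreme_point_exists_convex by (metis convex_convex_hull)
  have kT: "k \<in> ?T"
    using extreme_point_of_convex_hull[OF k] .
  have ext: "k \<notin> open_segment u v" if "u \<in> ?T" "v \<in> ?T" for u v
    using k that hull_inc unfolding extreme_point_of_def by metis
  have "k \<noteq> n"
    using ext xy by blast
  moreover have kN: "k \<in> N"
    using kT unfolding line_def by blast
  moreover have "extreme k n"
    unfolding extreme_def using ext line_eq[OF kT \<open>k \<noteq> n\<close>] line_commute by metis
  moreover have "\<not> extreme n k"
    using extreme_cong[OF kT \<open>k \<noteq> n\<close>] assms(3) by blast
  ultimately show ?thesis
    using kT assms(1) unfolding cutter_def by blast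
qed

text \<open>Seen from an end \<open>n\<close> of the line, all other members lie in the same
  direction, \<open>k = n + u *\<^sub>R (m - n)\<close> with \<open>u > 0\<close>, and on the
  hyperplane of \<open>n\<close> only the multiple of \<open>m\<close> survives.\<close>

lemma extreme_same_sign:
  assumes "extreme n m" "k \<in> line n m" "m \<in> N" "k \<noteq> n"
  shows "\<exists>u>0. \<forall>q\<in>hyp n. k \<bullet> q = u * (m \<bullet> q)"
proof -
  obtain u where k: "k = n + u *\<^sub>R (m - n)"
    using assms(2) unfolding line_def affine_hull_2_alt by auto
  have "0 < u"
  proof (rule ccontr)
    assume "\<not> 0 < u"
    then have u: "u < 0"
      using k assms(4) by (cases "u = 0") auto
    \<comment> \<open>The solution of \<open>(1 - s) * u + s = 0\<close>; for negative
      \<open>u\<close> it exhibits \<open>n\<close> strictly between \<open>k\<close> and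
      \<open>m\<close>.\<close>
    define s where "s = - u / (1 - u)"
    have s: "0 < s" "s < 1"
      using u unfolding s_def by (auto simp: field_simps)
    have su: "(1 - s) * u + s = 0"
      using u unfolding s_def by (simp add: field_simps)
    have "(1 - s) *\<^sub>R k + s *\<^sub>R m = n + ((1 - s) * u + s) *\<^sub>R (m - n)"
      unfolding k by (simp add: algebra_simps)
    then have "n = (1 - s) *\<^sub>R k + s *\<^sub>R m"
      using su by simp
    moreover have "k \<noteq> m"
    proof
      assume "k = m"
      then have "1 *\<^sub>R (m - n) = u *\<^sub>R (m - n)"
        using k by (metis add_diff_cancel_left' scaleR_one)
      then show False
        using u \<open>k = m\<close> assms(4) unfolding scaleR_cancel_right by simp
    qed
    ultimately have "n \<in> open_segment k m"
      using s unfolding in_segment by blast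
    moreover have "m \<in> line n m"
      unfolding line_def using assms(3) by (simp add: hull_inc)
    ultimately show False
      using assms(1,2) unfolding extreme_def by blast
  qed
  moreover have "k \<bullet> q = u * (m \<bullet> q)" if "q \<in> hyp n" for q
    using that unfolding k by (simp add: inner_add_left inner_diff_left)
  ultimately show ?thesis
    by blast
qed

text \<open>A gallery step within the hyperplane of \<open>n\<close> crosses all hyperplanes with
  the same trace as \<open>m\<close>, that is, all of \<open>line n m\<close> except
  \<open>n\<close>. They are among those that distinguish \<open>a\<close> from \<open>a'\<close>,
  so none of them cuts \<open>n\<close>. This makes \<open>n\<close> an end of the line, and the
  crossed normals have a common sign at \<open>q\<close>, whence the inclusion.\<close>

lemma walk_chambers:
  assumes e: "cover_edge chambers a n" "cover_edge chambers a' n"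
    and agree: "\<forall>k. cutter k n \<longrightarrow> (k \<in> a \<longleftrightarrow> k \<in> a')" and neq: "a \<noteq> a'"
  shows "\<exists>c. cover_edge chambers c n \<and> (\<forall>k. cutter k n \<longrightarrow> (k \<in> c \<longleftrightarrow> k \<in> a)) \<and>
    card (sym_diff c a') < card (sym_diff a a') \<and> (a \<subseteq> c \<or> c \<subseteq> a)"
proof -
  let ?C = "N - {n}"
  have nN: "n \<in> N"
    using e cover_edge_iff by blast
  obtain q where q: "n \<bullet> q = 0" "\<forall>m\<in>?C. m \<bullet> q \<noteq> 0" "pos N q = a"
    using e(1) cover_edge_iff by blast
  obtain q' where q': "n \<bullet> q' = 0" "\<forall>m\<in>?C. m \<bullet> q' \<noteq> 0" "pos N q' = a'"
    using e(2) cover_edge_iff by blast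
  have pos: "pos ?C x = pos N x" if "n \<bullet> x = 0" for x
    using that unfolding pos_def by auto
  have "pos ?C q \<noteq> pos ?C q'"
    using pos q q' neq by simp
  then have "\<exists>r\<in>hyp n. \<exists>m\<in>sym_diff (pos ?C q) (pos ?C q'). (\<forall>k\<in>?C. k \<bullet> r \<noteq> 0) \<and>
    sym_diff (pos ?C q) (pos ?C r) \<subseteq> sym_diff (pos ?C q) (pos ?C q') \<and>
    (\<forall>k\<in>?C. k \<in> sym_diff (pos ?C q) (pos ?C r) \<longleftrightarrow> (\<exists>c. \<forall>v\<in>hyp n. k \<bullet> v = c * (m \<bullet> v)))"
    using q q' finite_N by (intro gallery_step subspace_hyp) auto
  then obtain r m where "r \<in> hyp n" "m \<in> sym_diff (pos ?C q) (pos ?C q')" "\<forall>k\<in>?C. k \<bullet> r \<noteq> 0"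
    "sym_diff (pos ?C q) (pos ?C r) \<subseteq> sym_diff (pos ?C q) (pos ?C q')"
    "\<forall>k\<in>?C. k \<in> sym_diff (pos ?C q) (pos ?C r) \<longleftrightarrow> (\<exists>c. \<forall>v\<in>hyp n. k \<bullet> v = c * (m \<bullet> v))"
    by metis
  then have r: "n \<bullet> r = 0" "m \<in> sym_diff a a'" "\<forall>k\<in>?C. k \<bullet> r \<noteq> 0"
    and sub: "sym_diff a (pos N r) \<subseteq> sym_diff a a'"
    and sd: "\<forall>k\<in>?C. k \<in> sym_diff a (pos N r) \<longleftrightarrow> (\<exists>c. \<forall>v\<in>hyp n. k \<bullet> v = c * (m \<bullet> v))"
    using pos[of q] pos[of q'] pos[of r] q q' by simp_all
  have mC: "m \<in> ?C"
    using r(2) q(1,3) q'(1,3) unfolding pos_def by auto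
  have iff: "(\<exists>c. \<forall>v\<in>hyp n. k \<bullet> v = c * (m \<bullet> v)) \<longleftrightarrow> k \<in> line n m" if k: "k \<in> ?C" for k
  proof
    assume "\<exists>c. \<forall>v\<in>hyp n. k \<bullet> v = c * (m \<bullet> v)"
    then have "hyp n \<inter> hyp m \<subseteq> hyp k"
      by fastforce
    then show "k \<in> line n m"
      using mem_line_iff k nN mC by blast
  next
    assume "k \<in> line n m"
    then obtain u where "k = n + u *\<^sub>R (m - n)"
      unfolding line_def affine_hull_2_alt by auto
    then have "\<forall>v\<in>hyp n. k \<bullet> v = u * (m \<bullet> v)"
      by (simp add: inner_add_left inner_diff_left)
    then show "\<exists>c. \<forall>v\<in>hyp n. k \<bullet> v = c * (m \<bullet> v)"
      by blast
  qed
  define D where "D = line n m - {n}"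
  have D: "sym_diff a (pos N r) = D"
  proof -
    have "n \<notin> a" "n \<notin> pos N r" "a \<subseteq> N" "pos N r \<subseteq> N"
      using q r(1) unfolding pos_def by auto
    moreover have "line n m \<subseteq> N"
      unfolding line_def by blast
    ultimately have "k \<in> sym_diff a (pos N r) \<longleftrightarrow> k \<in> D" for k
      using sd iff unfolding D_def by (cases "k \<in> ?C") auto
    then show ?thesis
      by (intro Set.set_eqI)
  qed
  have mD: "m \<in> D"
    using mem_line[OF nN] mC unfolding D_def by blast
  have nocut: "\<not> cutter k n" if "k \<in> D" for k
    using that D sub agree by blast
  \<comment> \<open>Otherwise some end of the line would be a cutter of \<open>n\<close> crossed by
    the step.\<close>
  have ext: "extreme n m"
    using ex_extreme_cutter[OF nN, of m] mC nocut unfolding D_def cutter_def by blast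
  have "0 < k \<bullet> q \<longleftrightarrow> 0 < m \<bullet> q" if "k \<in> D" for k
    using extreme_same_sign[OF ext, of k] that mC q(1) unfolding D_def
    by (auto simp: zero_less_mult_iff)
  then have "D \<subseteq> a \<or> D \<inter> a = {}"
    using q(3) unfolding pos_def D_def line_def by auto
  then have "a \<subseteq> pos N r \<or> pos N r \<subseteq> a"
    using D by blast
  moreover have "cover_edge chambers (pos N r) n"
    unfolding cover_edge_iff using nN r by blast
  moreover have "\<forall>k. cutter k n \<longrightarrow> (k \<in> pos N r \<longleftrightarrow> k \<in> a)"
    using nocut D by blast
  moreover have "card (sym_diff (pos N r) a') < card (sym_diff a a')"
  proof (rule psubset_card_mono)
    show "finite (sym_diff a a')"
      using q(3) q'(3) finite_N unfolding pos_def by auto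
    show "sym_diff (pos N r) a' \<subset> sym_diff a a'"
      using D mD sub by blast
  qed
  ultimately show ?thesis
    by blast
qed

text \<open>The hypothesis is the form in which tightness will be supplied. A polygon consists of
  the normals between \<open>k\<close> and \<open>l\<close>: convex combinations of forms positive
  at a point are positive there, and an end of the segment is an end of the whole line, so nothing
  on it cuts \<open>k\<close>.\<close>

lemma polygonal_system:
  assumes poly: "\<And>w k l. cover_edge chambers w k \<Longrightarrow> cover_edge chambers w l \<Longrightarrow> k \<noteq> l \<Longrightarrow>
    line k l \<subseteq> closed_segment k l \<and> w \<union> (N \<inter> closed_segment k l) \<in> chambers"
  shows "polygonal_system N chambers (\<lambda>k l. N \<inter> closed_segment k l) cutter"
proof
  show "N \<inter> closed_segment k l \<subseteq> w" if w: "w \<in> chambers" "k \<in> w" "l \<in> w" for w k l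
  proof
    fix m
    assume m: "m \<in> N \<inter> closed_segment k l"
    obtain x where x: "w = pos N x"
      using w(1) by (rule chambersE)
    obtain u where u: "m = (1 - u) *\<^sub>R k + u *\<^sub>R l" "0 \<le> u" "u \<le> 1"
      using m unfolding closed_segment_def by blast
    have "0 < k \<bullet> x" "0 < l \<bullet> x"
      using w x unfolding pos_def by auto
    then have "0 < (1 - u) * (k \<bullet> x) + u * (l \<bullet> x)"
      using u by (cases "u = 0") (auto simp: add_nonneg_pos)
    then show "m \<in> w"
      using m unfolding x pos_def u(1) by (auto simp: inner_add_left)
  qed
  show "\<not> cutter m k"
    if e: "cover_edge chambers w k" "cover_edge chambers w l" "k \<noteq> l" and m: "m \<in> N \<inter> closed_segment k l"
    for w k l m
  proof (cases "m = k")
    case False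
    have kl: "line k l \<subseteq> closed_segment k l" "k \<in> N" "l \<in> N"
      using poly[OF e] e cover_edge_iff by auto
    have "k extreme_point_of closed_segment k l"
      by (simp add: extreme_point_of_segment)
    then have "extreme k l"
      using kl(1) unfolding extreme_def extreme_point_of_def by blast
    moreover have "m \<in> line k l"
      using m convex_hull_subset_affine_hull unfolding line_def segment_convex_hull by blast
    ultimately have "extreme k m"
      using extreme_cong False by blast
    then show ?thesis
      unfolding cutter_def by blast
  qed (simp add: cutter_def)
qed (use finite_N chambers_subset empty_chamber compl_chamber chain_chambers poly walk_chambers in auto)

end

section \<open>Regions, facets and shards in terms of normal vectors\<close>

context normal_system
begin

definition region :: "'a set \<Rightarrow> 'a set" where
  "region w = sign_cone UNIV N w"

text \<open>Indexed by one of its walls \<open>(a, n)\<close>. Only the cutters of \<open>n\<close>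
  in \<open>a\<close> matter, so all walls that agree give the same shard.\<close>

definition shard :: "'a set \<Rightarrow> 'a \<Rightarrow> 'a set" where
  "shard a n = sign_cone (hyp n) {k. cutter k n} a"

lemma regions_hyp: "regions (hyp ` T) = (\<lambda>x. sign_cone UNIV T (pos T x)) ` {x. \<forall>k\<in>T. k \<bullet> x \<noteq> 0}"
  unfolding regions_def using closure_components_complement[OF subspace_UNIV, of T] by simp

lemma regions_eq: "regions (hyp ` N) = region ` chambers"
  unfolding regions_hyp chambers_def region_def by (simp add: image_image)

lemma mem_region: "y \<in> region w \<longleftrightarrow> (\<forall>k\<in>N. if k \<in> w then 0 \<le> k \<bullet> y else k \<bullet> y \<le> 0)"
  unfolding region_def sign_cone_def by simp

lemma mem_shard:
  "y \<in> shard a n \<longleftrightarrow> n \<bullet> y = 0 \<and> (\<forall>k. cutter k n \<longrightarrow> (if k \<in> a then 0 \<le> k \<bullet> y else k \<bullet> y \<le> 0))"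
  unfolding shard_def sign_cone_def by auto

lemma convex_region: "convex (region w)"
  unfolding region_def by (simp add: convex_sign_cone)

lemma convex_shard: "convex (shard a n)"
  unfolding shard_def by (simp add: convex_sign_cone subspace_hyp)

lemma base_mem: "b \<in> region {}"
  unfolding mem_region using normalised by simp

lemma hyp_inj_on: "inj_on hyp N"
  using hyp_inj by (auto intro!: inj_onI)

lemma hyp_not_subset:
  assumes "m \<in> N" "n \<in> N" "m \<noteq> n"
  shows "\<exists>v\<in>hyp n. m \<bullet> v \<noteq> 0"
  using hyp_inj assms by fastforce

section \<open>Dimensions, separating sets and facets\<close>

lemma dim_hyp:
  assumes "n \<in> N"
  shows "int (dim (hyp n)) = int DIM('a) - 1"
  using dim_hyperplane[OF nonzero[OF assms]] DIM_positive[where 'a='a] unfolding hyp_def by simp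

lemma dim_hyp_Int:
  assumes "k \<in> N" "n \<in> N" "k \<noteq> n"
  shows "dim (hyp k \<inter> hyp n) + 2 = DIM('a)"
proof -
  have "k \<notin> span {n}"
    using eq_of_scaled assms by (auto simp: span_singleton)
  then have "independent {k, n}"
    using nonzero[OF assms(2)] by (simp add: independent_insert assms(3))
  then have "dim (span {k, n}) = 2"
    using assms(3) by (simp add: dim_eq_card_independent)
  moreover have "{y \<in> UNIV. \<forall>x\<in>span {k, n}. orthogonal x y} = hyp k \<inter> hyp n"
  proof -
    have "orthogonal x y" if "x \<in> span {k, n}" "k \<bullet> y = 0" "n \<bullet> y = 0" for x y
      using orthogonal_to_span[of x "{k, n}" y] that
      by (auto simp: orthogonal_def inner_commute)
    then show ?thesis
      by (auto simp: orthogonal_def intro: span_base)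
  qed
  ultimately show ?thesis
    using dim_subspace_orthogonal_to_vectors[of "span {k, n}" UNIV] by simp
qed

lemma span_eq_hyp:
  assumes "n \<in> N" "F \<subseteq> hyp n" "0 \<in> F" "aff_dim F = int DIM('a) - 1"
  shows "span F = hyp n"
proof -
  have "aff_dim F = int (dim F)"
    using assms(3) by (intro aff_dim_zero hull_inc)
  then show ?thesis
    using assms dim_hyp[of n] span_minimal[OF assms(2) subspace_hyp]
    by (intro subspace_dim_equal) (auto simp: subspace_hyp)
qed

lemma wall_point:
  assumes "n \<in> N" "convex Z" "Z \<subseteq> hyp n" "aff_dim Z = int DIM('a) - 1"
  shows "\<exists>q\<in>Z. \<forall>m\<in>N - {n}. m \<bullet> q \<noteq> 0"
proof -
  have "\<exists>q\<in>Z. \<forall>m\<in>N - {n}. (\<exists>v\<in>hyp n. m \<bullet> v \<noteq> 0) \<longrightarrow> m \<bullet> q \<noteq> 0"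
    using assms dim_hyp finite_N by (intro generic_point_of_full_dim subspace_hyp) auto
  then show ?thesis
    using hyp_not_subset assms(1) by blast
qed

text \<open>Converse to \<open>wall_point\<close>: the points of the hyperplane with the same strict
  signs as \<open>q\<close> form a relatively open subset contained in \<open>Z\<close>.\<close>

lemma wall_dim:
  assumes n: "n \<in> N" and q: "n \<bullet> q = 0" "\<forall>m\<in>C. m \<bullet> q \<noteq> 0" and C: "finite C"
    and Z: "Z \<subseteq> hyp n" "\<And>y. n \<bullet> y = 0 \<Longrightarrow> \<forall>m\<in>C. 0 < (m \<bullet> q) * (m \<bullet> y) \<Longrightarrow> y \<in> Z"
  shows "aff_dim Z = int DIM('a) - 1"
proof -
  have "q \<in> {y. \<forall>m\<in>C. 0 < (m \<bullet> q) * (m \<bullet> y)}"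
    using q(2) by (auto simp: zero_less_mult_iff)
  then have "aff_dim Z = int (dim (hyp n))"
    using q Z by (intro full_dim_of_open[OF subspace_hyp Z(1) open_same_sign[OF C, of q]]) auto
  then show ?thesis
    using dim_hyp[OF n] by simp
qed

lemma cell_dim:
  fixes T :: "'a set"
  assumes T: "finite T" and x: "\<forall>m\<in>T. m \<bullet> x \<noteq> 0"
  shows "aff_dim (sign_cone UNIV T (pos T x)) = int DIM('a)"
proof -
  have "x \<in> {y. \<forall>m\<in>T. 0 < (m \<bullet> x) * (m \<bullet> y)}"
    using x by (auto simp: zero_less_mult_iff)
  moreover have "{y. \<forall>m\<in>T. 0 < (m \<bullet> x) * (m \<bullet> y)} \<subseteq> sign_cone UNIV T (pos T x)"
    unfolding sign_cone_def pos_def by (fastforce simp: zero_less_mult_iff)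
  ultimately have "aff_dim (sign_cone UNIV T (pos T x)) = int (dim (UNIV :: 'a set))"
    by (intro full_dim_of_open[OF subspace_UNIV _ open_same_sign[OF T, of x]]) auto
  then show ?thesis
    by simp
qed

text \<open>A vector witnessing separation is a multiple \<open>c\<close> of \<open>n\<close>. The
  base point \<open>b\<close> forces \<open>c\<close> to be negative, and the generic point
  \<open>x\<close> of the region then has \<open>n \<bullet> x\<close> positive.\<close>

lemma sep_set_region:
  assumes "w \<in> chambers"
  shows "sep_set (hyp ` N) (region {}) (region w) = hyp ` w"
proof -
  obtain x where x: "\<forall>m\<in>N. m \<bullet> x \<noteq> 0" "w = pos N x"
    using assms by (rule chambersE)
  have "separates (hyp n) (region w) (region {}) \<longleftrightarrow> n \<in> w" if n: "n \<in> N" for n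
  proof
    assume "n \<in> w"
    then show "separates (hyp n) (region w) (region {})"
      unfolding separates_def using nonzero[OF n] n mem_region
      by (intro exI[of _ "- n"]) (auto simp: hyp_def)
  next
    assume "separates (hyp n) (region w) (region {})"
    then obtain a where a: "a \<noteq> 0" "hyp n = {x. a \<bullet> x = 0}"
      "\<forall>x\<in>region w. a \<bullet> x \<le> 0" "\<forall>x\<in>region {}. a \<bullet> x \<ge> 0"
      unfolding separates_def by blast
    have "a \<in> span {n}"
      using a(2) by (intro in_span_of_orthogonal) (auto simp: hyp_def)
    then obtain c where c: "a = c *\<^sub>R n"
      by (auto simp: span_singleton)
    have "x \<in> region w"
      using x unfolding mem_region pos_def by auto
    then have "c * (n \<bullet> x) \<le> 0"
      using a(3) c by auto
    moreover have "c * (n \<bullet> b) \<ge> 0"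
      using a(4) base_mem c by auto
    moreover have "c \<noteq> 0"
      using a(1) c by auto
    ultimately have "0 \<le> n \<bullet> x"
      using normalised[OF n] by (simp add: mult_le_0_iff)
    then show "n \<in> w"
      using x n unfolding pos_def by (auto simp: order_le_less)
  qed
  then show ?thesis
    using chambers_subset[OF assms] unfolding sep_set_def by auto
qed

lemma le_region:
  assumes "w \<in> chambers" "w' \<in> chambers"
  shows "region w \<sqsubseteq>\<^bsub>Pos (hyp ` N) (region {})\<^esub> region w' \<longleftrightarrow> w \<subseteq> w'"
  unfolding Pos_def using assms sep_set_region inj_on_image_subset_iff[OF hyp_inj_on] chambers_subset
  by simp

lemma region_inj:
  assumes "w \<in> chambers" "w' \<in> chambers" "region w = region w'"
  shows "w = w'"
  using sep_set_region assms inj_on_image_eq_iff[OF hyp_inj_on] chambers_subset by metis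

lemma face_region:
  assumes "\<forall>y\<in>S. k \<bullet> y \<le> 0" "convex S"
  shows "S \<inter> hyp k face_of S"
  using face_of_Int_supporting_hyperplane_le[OF assms(2), of k 0] assms(1) unfolding hyp_def by auto

text \<open>The second claim recovers the hyperplane from the facet, so that distinct cover edges of
  a region give distinct facets, as tightness requires.\<close>

lemma upper_facet_region:
  assumes "cover_edge chambers w k"
  shows "upper_facet (hyp ` N) (region {}) (region w) (region w \<inter> hyp k)"
    and "span (region w \<inter> hyp k) = hyp k"
proof -
  obtain q where q: "k \<in> N" "k \<bullet> q = 0" "\<forall>m\<in>N - {k}. m \<bullet> q \<noteq> 0" "pos N q = w"
    using assms cover_edge_iff by blast
  have w: "w \<in> chambers" "k \<notin> w"
    using assms unfolding cover_edge_def by auto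
  have dimF: "aff_dim (region w \<inter> hyp k) = int DIM('a) - 1"
  proof (rule wall_dim[OF q(1-3)])
    fix y
    assume y: "k \<bullet> y = 0" "\<forall>m\<in>N - {k}. 0 < (m \<bullet> q) * (m \<bullet> y)"
    have "if m \<in> w then 0 \<le> m \<bullet> y else m \<bullet> y \<le> 0" if m: "m \<in> N" for m
    proof (cases "m = k")
      case False
      have "m \<in> w \<longleftrightarrow> 0 < m \<bullet> q"
        using q(4) m unfolding pos_def by blast
      moreover have "0 < (m \<bullet> q) * (m \<bullet> y)"
        using y(2) m False by blast
      ultimately show ?thesis
        by (auto simp: zero_less_mult_iff)
    qed (use y(1) in simp)
    then show "y \<in> region w \<inter> hyp k"
      unfolding Int_iff mem_region using y(1) by (intro conjI ballI) simp_all
  qed (use finite_N in auto)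
  obtain x where x: "\<forall>m\<in>N. m \<bullet> x \<noteq> 0" "w = pos N x"
    using w(1) by (rule chambersE)
  have "aff_dim (region w) = int DIM('a)"
    unfolding region_def x(2) by (rule cell_dim[OF finite_N x(1)])
  moreover have "region w \<inter> hyp k face_of region w"
    using w q(1) by (intro face_region convex_region) (auto simp: mem_region)
  moreover have zero: "0 \<in> region w \<inter> hyp k"
    by (simp add: mem_region)
  ultimately have "region w \<inter> hyp k facet_of region w"
    using dimF unfolding facet_of_def by auto
  moreover show span: "span (region w \<inter> hyp k) = hyp k"
    using span_eq_hyp[OF q(1) _ zero dimF] by blast
  moreover have "hyp k \<notin> hyp ` w"
    using inj_on_image_mem_iff[OF hyp_inj_on q(1) chambers_subset[OF w(1)]] w(2) by blast
  ultimately show "upper_facet (hyp ` N) (region {}) (region w) (region w \<inter> hyp k)"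
    unfolding upper_facet_def sep_set_region[OF w(1)] by simp
qed

text \<open>Two upper walls of a tight region meet in a codimension-two face, and no further hyperplane
  of their rank-two subarrangement can pass between them. Crossing all of the subarrangement at a
  generic point \<open>p\<close> of that face leads to the region opposite in \<open>p\<close>.\<close>

lemma tight_polygon:
  assumes tight: "tight (hyp ` N) (region {})"
    and e: "cover_edge chambers w k" "cover_edge chambers w l" "k \<noteq> l"
  shows "line k l \<subseteq> closed_segment k l \<and> w \<union> (N \<inter> closed_segment k l) \<in> chambers"
proof -
  obtain q where q: "k \<in> N" "k \<bullet> q = 0" "\<forall>m\<in>N - {k}. m \<bullet> q \<noteq> 0" "pos N q = w"
    using e(1) cover_edge_iff by blast
  obtain q' where q': "l \<in> N" "l \<bullet> q' = 0" "\<forall>m\<in>N - {l}. m \<bullet> q' \<noteq> 0" "pos N q' = w"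
    using e(2) cover_edge_iff by blast
  have w: "w \<in> chambers" "k \<notin> w" "l \<notin> w"
    using e unfolding cover_edge_def by auto
  obtain x where x: "\<forall>m\<in>N. m \<bullet> x \<noteq> 0" "w = pos N x"
    using w(1) by (rule chambersE)
  let ?R = "region w" and ?V = "hyp k \<inter> hyp l"
  have ne: "?R \<inter> hyp k \<noteq> ?R \<inter> hyp l"
    using upper_facet_region(2)[OF e(1)] upper_facet_region(2)[OF e(2)] hyp_inj[OF q(1) q'(1)] e(3)
    by (metis order_refl)
  have "tight_region (hyp ` N) (region {}) ?R"
    using tight imageI[OF w(1)] unfolding tight_def regions_eq by (rule bspec)
  note this[unfolded tight_region_def, THEN conjunct2, rule_format]
  then have "codim2_face ((?R \<inter> hyp k) \<inter> (?R \<inter> hyp l)) ?R"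
    using upper_facet_region(1)[OF e(1)] upper_facet_region(1)[OF e(2)] ne by simp
  moreover have "(?R \<inter> hyp k) \<inter> (?R \<inter> hyp l) = ?R \<inter> ?V"
    by blast
  ultimately have "aff_dim (?R \<inter> ?V) = int DIM('a) - 2"
    unfolding codim2_face_def by simp
  then have "aff_dim (?R \<inter> ?V) = int (dim ?V)"
    using dim_hyp_Int[OF q(1) q'(1) e(3)] by simp
  moreover have V: "subspace ?V"
    by (simp add: subspace_inter subspace_hyp)
  moreover have "convex (?R \<inter> ?V)"
    by (intro convex_Int convex_region subspace_imp_convex V)
  ultimately have "\<exists>p\<in>?R \<inter> ?V. \<forall>m\<in>N. (\<exists>v\<in>?V. m \<bullet> v \<noteq> 0) \<longrightarrow> m \<bullet> p \<noteq> 0"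
    using finite_N by (intro generic_point_of_full_dim) auto
  then obtain p where p: "p \<in> ?R \<inter> ?V" "\<forall>m\<in>N. (\<exists>v\<in>?V. m \<bullet> v \<noteq> 0) \<longrightarrow> m \<bullet> p \<noteq> 0"
    by (elim bexE)
  have onp: "m \<in> line k l" if "m \<in> N" "m \<bullet> p = 0" for m
    using mem_line_iff[OF that(1) q(1) q'(1)] p(2) that by fastforce
  have seg: "m \<in> closed_segment k l" if m: "m \<in> line k l" for m
  proof (cases "m = k \<or> m = l")
    case False
    have mN: "m \<in> N"
      using m unfolding line_def by blast
    obtain u where "m = k + u *\<^sub>R (l - k)"
      using m unfolding line_def affine_hull_2_alt by blast
    then have u: "m = (1 - u) *\<^sub>R k + u *\<^sub>R l"
      by (simp add: algebra_simps)
    \<comment> \<open>On each of the two walls one term of \<open>m\<close> drops out. As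
      \<open>q\<close> and \<open>q'\<close> both have sign set \<open>w\<close>, the form
      \<open>m\<close> is positive at both or at neither. With \<open>l \<bullet> q\<close> and
      \<open>k \<bullet> q'\<close> negative, neither \<open>u < 0\<close> nor \<open>u > 1\<close>
      is possible.\<close>
    have "m \<bullet> q = u * (l \<bullet> q)" "m \<bullet> q' = (1 - u) * (k \<bullet> q')"
      using q(2) q'(2) unfolding u by (simp_all add: inner_add_left)
    moreover have "l \<bullet> q < 0" "k \<bullet> q' < 0"
      using q q' w e(3) unfolding pos_def by (force simp: order_le_less not_less)+
    moreover have "m \<in> w \<longleftrightarrow> 0 < m \<bullet> q" "m \<in> w \<longleftrightarrow> 0 < m \<bullet> q'"
      using mN q(4) q'(4) unfolding pos_def by blast+
    ultimately have "0 \<le> u \<and> u \<le> 1"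
      by (auto simp: zero_less_mult_iff)
    then show ?thesis
      using u unfolding closed_segment_def by blast
  qed auto
  have kl: "k \<bullet> x < 0" "l \<bullet> x < 0"
    using x w q(1) q'(1) unfolding pos_def by (force simp: order_le_less not_less)+
  have neg: "m \<bullet> x < 0" if m: "m \<in> line k l" for m
  proof -
    obtain u where u: "m = (1 - u) *\<^sub>R k + u *\<^sub>R l" "0 \<le> u" "u \<le> 1"
      using seg[OF m] unfolding closed_segment_def by blast
    have "(1 - u) * (k \<bullet> x) + u * (l \<bullet> x) < 0"
      using u(2,3) kl by (cases "u = 0") (auto simp: add_nonpos_neg mult_nonneg_nonpos mult_pos_neg)
    then show ?thesis
      unfolding u(1) by (simp add: inner_add_left)
  qed
  have onp': "m \<bullet> p = 0" if "m \<in> line k l" for m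
    using that p(1) mem_line_iff[OF _ q(1) q'(1), of m] unfolding line_def by auto
  obtain t where t: "t > 0" "\<forall>m\<in>N. m \<bullet> p \<noteq> 0 \<longrightarrow> 0 < (m \<bullet> p) * (m \<bullet> (p + t *\<^sub>R (- x)))"
    using ex_small_step[OF finite_N open_UNIV, of p "- x"] by blast
  \<comment> \<open>Through \<open>p\<close>, away from the interior point \<open>x\<close>: the
    normals on the line vanish at \<open>p\<close> and are negative at \<open>x\<close>, so they
    become positive; the others keep their sign at \<open>p\<close>.\<close>
  define y where "y = p + t *\<^sub>R (- x)"
  have y1: "0 < m \<bullet> y" if "m \<in> line k l" for m
    using neg[OF that] onp'[OF that] t(1) unfolding y_def by (simp add: inner_diff_right mult_pos_neg)
  have y2: "m \<bullet> y \<noteq> 0 \<and> (0 < m \<bullet> y \<longleftrightarrow> m \<in> w)" if m: "m \<in> N" "m \<notin> line k l" for m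
  proof -
    have "m \<bullet> p \<noteq> 0"
      using onp m by blast
    moreover have "if m \<in> w then 0 \<le> m \<bullet> p else m \<bullet> p \<le> 0"
      using p(1) m(1) mem_region by blast
    moreover have "0 < (m \<bullet> p) * (m \<bullet> y)"
      using t(2) m(1) \<open>m \<bullet> p \<noteq> 0\<close> unfolding y_def by blast
    ultimately show ?thesis
      by (auto simp: zero_less_mult_iff split: if_splits)
  qed
  have "N \<inter> closed_segment k l = line k l"
    using seg convex_hull_subset_affine_hull unfolding line_def segment_convex_hull by blast
  moreover have "pos N y = w \<union> line k l"
    using y1 y2 chambers_subset[OF w(1)] unfolding pos_def line_def by blast
  moreover have "pos N y \<in> chambers"
    using y1 y2 by (intro chambersI) force
  ultimately show ?thesis
    using seg by auto
qed

text \<open>The region of the subarrangement around the base is the cone on which all normals of the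
  line are nonpositive. At a generic point of a facet on \<open>hyp k\<close> all of them but
  \<open>k\<close> are negative, so \<open>k\<close>, which vanishes there, lies strictly between no
  two of them. If \<open>k\<close> is extreme, a point of \<open>hyp k\<close> at which
  \<open>n\<close> is negative makes all others negative, and this gives a facet.\<close>

lemma basic_iff:
  assumes kn: "k \<in> N" "n \<in> N" "k \<noteq> n"
  shows "basic (hyp ` line k n) (region {}) (hyp k) \<longleftrightarrow> extreme k n"
proof
  let ?T = "line k n"
  have TN: "?T \<subseteq> N"
    unfolding line_def by blast
  have kT: "k \<in> ?T"
    using mem_line kn by blast
  {
    assume "basic (hyp ` ?T) (region {}) (hyp k)"
    then obtain B' F where B': "B' \<in> regions (hyp ` ?T)" "region {} \<subseteq> B'" and
      F: "F facet_of B'" "span F = hyp k"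
      unfolding basic_def by blast
    obtain x where x: "B' = sign_cone UNIV ?T (pos ?T x)" "\<forall>m\<in>?T. m \<bullet> x \<noteq> 0"
      using B'(1) unfolding regions_hyp by blast
    have "m \<notin> pos ?T x" if "m \<in> ?T" for m
    proof
      assume "m \<in> pos ?T x"
      then have "0 \<le> m \<bullet> b"
        using B'(2) base_mem that unfolding x(1) sign_cone_def by auto
      then show False
        using normalised that TN by fastforce
    qed
    then have le: "m \<bullet> y \<le> 0" if "m \<in> ?T" "y \<in> B'" for m y
      using that unfolding x(1) sign_cone_def by auto
    have "aff_dim F = int DIM('a) - 1"
      using F(1) cell_dim[OF finite_line x(2)] unfolding facet_of_def x(1) by simp
    moreover have "convex F"
      using F(1) facet_of_imp_face_of face_of_imp_convex by blast
    moreover have "F \<subseteq> hyp k"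
      using F(2) span_superset by blast
    ultimately obtain q where q: "q \<in> F" "\<forall>m\<in>N - {k}. m \<bullet> q \<noteq> 0" "k \<bullet> q = 0"
      using wall_point[OF kn(1), of F] by auto
    have neg: "m \<bullet> q < 0" if "m \<in> ?T" "m \<noteq> k" for m
    proof -
      have "m \<bullet> q \<le> 0"
        using le[OF that(1)] q(1) F(1) facet_of_imp_subset by blast
      moreover have "m \<bullet> q \<noteq> 0"
        using q(2) that TN by blast
      ultimately show ?thesis by simp
    qed
    show "extreme k n"
      unfolding extreme_def
    proof (intro ballI notI)
      fix y z
      assume yz: "y \<in> ?T" "z \<in> ?T" "k \<in> open_segment y z"
      then have "y \<noteq> k" "z \<noteq> k"
        by (auto simp: open_segment_def)
      then have "y \<bullet> q < 0" "z \<bullet> q < 0"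
        using neg yz by auto
      moreover obtain u where "0 < u" "u < 1" "k = (1 - u) *\<^sub>R y + u *\<^sub>R z"
        using yz(3) unfolding in_segment by blast
      ultimately have "k \<bullet> q < 0"
        by (simp add: inner_add_left add_neg_neg mult_pos_neg)
      then show False
        using q(3) by simp
    qed
  next
    assume ext: "extreme k n"
    obtain v where v: "k \<bullet> v = 0" "n \<bullet> v \<noteq> 0"
      using hyp_not_subset[OF kn(2,1)] kn(3) by auto
    \<comment> \<open>Scaled so that \<open>n \<bullet> q\<close> is \<open>-1\<close>;
      \<open>extreme_same_sign\<close> carries the negative sign to the rest of the line.\<close>
    define q where "q = (- 1 / (n \<bullet> v)) *\<^sub>R v"
    have q: "k \<bullet> q = 0" "n \<bullet> q = -1"
      using v unfolding q_def by auto
    have neg: "m \<bullet> q < 0" if "m \<in> ?T - {k}" for m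
      using extreme_same_sign[OF ext, of m] that q kn(2) by (auto simp: mult_pos_neg)
    let ?B = "sign_cone UNIV ?T {}"
    have gen: "\<forall>m\<in>?T. m \<bullet> b \<noteq> 0"
      using normalised TN by fastforce
    have "pos ?T b = {}"
      using pos_b TN unfolding pos_def by blast
    then have B: "?B \<in> regions (hyp ` ?T)" "aff_dim ?B = int DIM('a)"
      using gen cell_dim[OF finite_line gen] unfolding regions_hyp by (auto intro!: image_eqI[of _ _ b])
    have dimF: "aff_dim (?B \<inter> hyp k) = int DIM('a) - 1"
    proof (rule wall_dim[OF kn(1) q(1), of "?T - {k}"])
      fix y
      assume y: "k \<bullet> y = 0" "\<forall>m\<in>?T - {k}. 0 < (m \<bullet> q) * (m \<bullet> y)"
      have "m \<bullet> y \<le> 0" if "m \<in> ?T" for m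
        using y that neg by (cases "m = k") (force simp: zero_less_mult_iff)+
      then show "y \<in> ?B \<inter> hyp k"
        using y(1) unfolding sign_cone_def by simp
    next
      show "\<forall>m\<in>?T - {k}. m \<bullet> q \<noteq> 0"
        using neg by (metis less_irrefl)
    qed (use finite_line in auto)
    have zero: "0 \<in> ?B \<inter> hyp k"
      unfolding sign_cone_def by simp
    have "?B \<inter> hyp k face_of ?B"
      using kT by (intro face_region convex_sign_cone subspace_UNIV) (auto simp: sign_cone_def)
    then have "?B \<inter> hyp k facet_of ?B"
      using dimF B(2) zero unfolding facet_of_def by auto
    moreover have "span (?B \<inter> hyp k) = hyp k"
      using span_eq_hyp[OF kn(1) _ zero dimF] by blast
    moreover have "region {} \<subseteq> ?B"
      using TN unfolding region_def sign_cone_def by auto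
    ultimately show "basic (hyp ` ?T) (region {}) (hyp k)"
      using B(1) unfolding basic_def by blast
  }
qed

text \<open>A subspace of codimension two contained in both hyperplanes equals their intersection,
  which makes the rank-two subarrangement unique.\<close>

lemma rank_two_subarr_hyp:
  assumes kn: "k \<in> N" "n \<in> N" "k \<noteq> n"
  shows "rank_two_subarr (hyp ` N) A' \<and> hyp k \<in> A' \<and> hyp n \<in> A' \<longleftrightarrow> A' = hyp ` line k n"
proof -
  have eq: "{H \<in> hyp ` N. hyp k \<inter> hyp n \<subseteq> H} = hyp ` line k n"
    using mem_line_iff[OF _ kn(1,2)] unfolding line_def by blast
  have ne: "hyp k \<noteq> hyp n"
    using hyp_inj kn by blast
  have U: "U = hyp k \<inter> hyp n" if "subspace U" "dim U + 2 = DIM('a)" "U \<subseteq> hyp k" "U \<subseteq> hyp n" for U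
    using that dim_hyp_Int[OF kn] by (intro subspace_dim_equal) (auto simp: subspace_inter subspace_hyp)
  have mem: "hyp k \<in> hyp ` line k n" "hyp n \<in> hyp ` line k n"
    using mem_line kn by auto
  have "card {hyp k, hyp n} \<le> card (hyp ` line k n)"
    using mem finite_line by (intro card_mono) auto
  then have "2 \<le> card (hyp ` line k n)"
    using ne by simp
  moreover have "subspace (hyp k \<inter> hyp n)"
    by (simp add: subspace_inter subspace_hyp)
  moreover have "hyp ` line k n \<subseteq> hyp ` N"
    unfolding line_def by blast
  ultimately have "rank_two_subarr (hyp ` N) (hyp ` line k n)"
    unfolding rank_two_subarr_def using eq[symmetric] dim_hyp_Int[OF kn]
    by (intro conjI exI[of _ "hyp k \<inter> hyp n"])
  moreover have "A' = hyp ` line k n"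
    if A': "rank_two_subarr (hyp ` N) A'" "hyp k \<in> A'" "hyp n \<in> A'"
  proof -
    obtain V where V: "subspace V" "dim V + 2 = DIM('a)" "A' = {H \<in> hyp ` N. V \<subseteq> H}"
      using A'(1) unfolding rank_two_subarr_def by (elim conjE exE)
    then have "V = hyp k \<inter> hyp n"
      using A'(2,3) by (intro U) auto
    then show ?thesis
      using V(3) eq by simp
  qed
  ultimately show ?thesis
    using mem by blast
qed

lemma cuts_iff:
  assumes "k \<in> N" "n \<in> N"
  shows "cuts (hyp ` N) (region {}) (hyp k) (hyp n) \<longleftrightarrow> cutter k n"
proof (cases "k = n")
  case True
  then show ?thesis
    unfolding cuts_def cutter_def by simp
next
  case False
  have "hyp n \<noteq> hyp k"
    using False hyp_inj assms by blast
  then show ?thesis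
    using rank_two_subarr_hyp[OF assms False] basic_iff[OF assms False] False assms
      basic_iff[OF assms(2,1)] line_commute[of n k]
    unfolding cuts_def cutter_def by (metis (no_types, lifting))
qed

section \<open>Shards and their adjacent regions\<close>

lemma finite_cutters: "finite {k. cutter k n}"
  by (rule finite_subset[OF _ finite_N]) (auto simp: cutter_def)

text \<open>Each component of the hyperplane minus the cutting ones is relatively open, so it has a
  point avoiding all other hyperplanes as well. Such a point is a wall, and its signs at the cutters
  determine the component.\<close>

lemma shards_in_hyp:
  assumes n: "n \<in> N"
  shows "shards_in (hyp ` N) (region {}) (hyp n) = {shard a n | a. cover_edge chambers a n}"
proof -
  let ?C = "{k. cutter k n}"
  have CN: "?C \<subseteq> N - {n}"
    unfolding cutter_def by blast
  have "{H' \<in> hyp ` N. cuts (hyp ` N) (region {}) H' (hyp n)} = hyp ` ?C"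
    using cuts_iff n CN by blast
  then have eq: "hyp n - (\<Union>H'\<in>{H' \<in> hyp ` N. cuts (hyp ` N) (region {}) H' (hyp n)}. H' \<inter> hyp n)
      = hyp n - (\<Union>k\<in>?C. hyp k)"
    by auto
  have "shards_in (hyp ` N) (region {}) (hyp n) =
      (\<lambda>x. sign_cone (hyp n) ?C (pos ?C x)) ` {x \<in> hyp n. \<forall>k\<in>?C. k \<bullet> x \<noteq> 0}"
    unfolding shards_in_def eq by (rule closure_components_complement[OF subspace_hyp])
  also have "\<dots> = {shard a n | a. cover_edge chambers a n}" (is "?L = ?R")
  proof
    show "?L \<subseteq> ?R"
    proof
      fix Z
      assume "Z \<in> ?L"
      then obtain x where x: "Z = sign_cone (hyp n) ?C (pos ?C x)" "n \<bullet> x = 0" "\<forall>k\<in>?C. k \<bullet> x \<noteq> 0"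
        by auto
      have "x \<in> {y. \<forall>k\<in>?C. 0 < (k \<bullet> x) * (k \<bullet> y)}"
        using x(3) by (auto simp: zero_less_mult_iff)
      then have "\<exists>q\<in>hyp n \<inter> {y. \<forall>k\<in>?C. 0 < (k \<bullet> x) * (k \<bullet> y)}.
          \<forall>m\<in>N - {n}. (\<exists>v\<in>hyp n. m \<bullet> v \<noteq> 0) \<longrightarrow> m \<bullet> q \<noteq> 0"
        using finite_N x(2)
        by (intro generic_nearby subspace_hyp open_same_sign finite_cutters) auto
      then obtain q where "q \<in> hyp n \<inter> {y. \<forall>k\<in>?C. 0 < (k \<bullet> x) * (k \<bullet> y)}" and
        q3: "\<forall>m\<in>N - {n}. (\<exists>v\<in>hyp n. m \<bullet> v \<noteq> 0) \<longrightarrow> m \<bullet> q \<noteq> 0"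
        by (elim bexE)
      then have q: "n \<bullet> q = 0" "\<forall>k\<in>?C. 0 < (k \<bullet> x) * (k \<bullet> q)"
        by simp_all
      have "cover_edge chambers (pos N q) n"
        unfolding cover_edge_iff using n q(1) q3 hyp_not_subset by blast
      moreover have "Z = shard (pos N q) n"
        unfolding x(1) shard_def
      proof (rule sign_cone_cong)
        fix k
        assume "k \<in> ?C"
        then show "k \<in> pos ?C x \<longleftrightarrow> k \<in> pos N q"
          using q(2) CN unfolding pos_def by (force simp: zero_less_mult_iff)
      qed
      ultimately show "Z \<in> ?R"
        by blast
    qed
    show "?R \<subseteq> ?L"
    proof
      fix Z
      assume "Z \<in> ?R"
      then obtain a where a: "Z = shard a n" "cover_edge chambers a n"
        by blast
      then obtain q where q: "n \<bullet> q = 0" "\<forall>m\<in>N - {n}. m \<bullet> q \<noteq> 0" "pos N q = a"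
        using cover_edge_iff by blast
      have "Z = sign_cone (hyp n) ?C (pos ?C q)"
        unfolding a(1) shard_def
        by (rule sign_cone_cong) (use CN q(3) in \<open>auto simp: pos_def\<close>)
      then show "Z \<in> ?L"
        using q CN by auto
    qed
  qed
  finally show ?thesis .
qed

lemma Sh_eq: "Sh (hyp ` N) (region {}) = {shard a n | a n. cover_edge chambers a n}"
proof -
  have "n \<in> N" if "cover_edge chambers a n" for a n
    using that cover_edge_iff by blast
  then show ?thesis
    unfolding Sh_def using shards_in_hyp by auto
qed

text \<open>A generic point of the wall lies in the shard and on no other hyperplane; this resolves
  the existential over hyperplanes in the sets of upper and lower regions.\<close>

lemma shard_in_unique:
  assumes "cover_edge chambers a n" "n' \<in> N" "shard a n \<in> shards_in (hyp ` N) (region {}) (hyp n')"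
  shows "n' = n"
proof -
  obtain q where q: "n \<bullet> q = 0" "\<forall>m\<in>N - {n}. m \<bullet> q \<noteq> 0" "pos N q = a"
    using assms(1) cover_edge_iff by blast
  have "q \<in> shard a n"
    unfolding mem_shard using q(1) q(3) unfolding cutter_def pos_def by auto
  then have "n' \<bullet> q = 0"
    using assms(3) unfolding shards_in_hyp[OF assms(2)] using mem_shard by fastforce
  then show ?thesis
    using q(2) assms(2) by blast
qed

text \<open>\<open>N \<inter> w - {n}\<close> is the lower side of the wall, whichever side
  \<open>w\<close> is on. A generic point of a full-dimensional intersection is a point of that
  wall, with the shard's signs at the cutters; conversely, a neighbourhood of a wall point in the
  hyperplane lies in both sets.\<close>

lemma region_meets_shard:
  assumes e: "cover_edge chambers a n"
  shows "aff_dim (region w \<inter> shard a n) = int DIM('a) - 1 \<longleftrightarrow>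
    cover_edge chambers (N \<inter> w - {n}) n \<and> (\<forall>k. cutter k n \<longrightarrow> (k \<in> a \<longleftrightarrow> k \<in> N \<inter> w - {n}))"
    (is "?dim \<longleftrightarrow> ?edge \<and> ?agree")
proof
  have n: "n \<in> N"
    using e cover_edge_iff by blast
  have cut: "k \<in> N - {n}" if "cutter k n" for k
    using that unfolding cutter_def by blast
  {
    assume dim: ?dim
    have "region w \<inter> shard a n \<subseteq> hyp n"
      using mem_shard by auto
    then obtain q where q: "q \<in> region w" "q \<in> shard a n" "\<forall>m\<in>N - {n}. m \<bullet> q \<noteq> 0"
      using wall_point[OF n _ _ dim] by (auto simp: convex_Int convex_region convex_shard)
    have nq: "n \<bullet> q = 0"
      using q(2) mem_shard by blast
    have "0 < m \<bullet> q \<longleftrightarrow> m \<in> w" if "m \<in> N - {n}" for m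
      using q(1,3) that unfolding mem_region by (cases "m \<in> w") (force simp: order_le_less)+
    then have "m \<in> pos N q \<longleftrightarrow> m \<in> N \<inter> w - {n}" for m
      using nq unfolding pos_def by (cases "m = n") auto
    then have eq: "pos N q = N \<inter> w - {n}"
      by blast
    then have ?edge
      using cover_edge_iff n nq q(3) by blast
    moreover have "k \<in> a \<longleftrightarrow> k \<in> pos N q" if "cutter k n" for k
      using q(2,3) cut[OF that] that unfolding mem_shard pos_def
      by (cases "k \<in> a") (force simp: order_le_less)+
    ultimately show "?edge \<and> ?agree"
      unfolding eq by blast
  next
    assume edge: "?edge \<and> ?agree"
    then obtain q where q: "n \<bullet> q = 0" "\<forall>m\<in>N - {n}. m \<bullet> q \<noteq> 0" "pos N q = N \<inter> w - {n}"
      using cover_edge_iff by blast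
    show ?dim
    proof (rule wall_dim[OF n q(1,2)])
      show "region w \<inter> shard a n \<subseteq> hyp n"
        using mem_shard by auto
      fix y
      assume y: "n \<bullet> y = 0" "\<forall>m\<in>N - {n}. 0 < (m \<bullet> q) * (m \<bullet> y)"
      have sgn: "if m \<in> w then 0 \<le> m \<bullet> y else m \<bullet> y \<le> 0" if "m \<in> N - {n}" for m
      proof -
        have "m \<in> w \<longleftrightarrow> 0 < m \<bullet> q"
          using q(3) that unfolding pos_def by blast
        moreover have "0 < (m \<bullet> q) * (m \<bullet> y)"
          using y(2) that by blast
        ultimately show ?thesis
          by (auto simp: zero_less_mult_iff)
      qed
      then have "y \<in> region w"
        using y(1) unfolding mem_region by (metis DiffI order_refl singletonD)
      moreover have "y \<in> shard a n"
        unfolding mem_shard using y(1) edge sgn cut by (metis DiffE DiffI IntE IntI)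
      ultimately show "y \<in> region w \<inter> shard a n"
        by blast
    qed (use finite_N in auto)
  }
qed

lemma sep_shard:
  assumes "cover_edge chambers a n" "w \<in> chambers"
  shows "(\<exists>H\<in>hyp ` N. shard a n \<in> shards_in (hyp ` N) (region {}) H \<and>
      H \<in> sep_set (hyp ` N) (region {}) (region w)) \<longleftrightarrow> n \<in> w"
    and "(\<exists>H\<in>hyp ` N. shard a n \<in> shards_in (hyp ` N) (region {}) H \<and>
      H \<notin> sep_set (hyp ` N) (region {}) (region w)) \<longleftrightarrow> n \<notin> w"
proof -
  have n: "n \<in> N"
    using assms(1) cover_edge_iff by blast
  have "shard a n \<in> shards_in (hyp ` N) (region {}) (hyp m) \<longleftrightarrow> m = n" if "m \<in> N" for m
    using shard_in_unique[OF assms(1) that] shards_in_hyp[OF n] assms(1) by blast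
  moreover have "hyp n \<in> sep_set (hyp ` N) (region {}) (region w) \<longleftrightarrow> n \<in> w"
    unfolding sep_set_region[OF assms(2)]
    using inj_on_image_mem_iff[OF hyp_inj_on n chambers_subset[OF assms(2)]] .
  ultimately show "(\<exists>H\<in>hyp ` N. shard a n \<in> shards_in (hyp ` N) (region {}) H \<and>
      H \<in> sep_set (hyp ` N) (region {}) (region w)) \<longleftrightarrow> n \<in> w"
    and "(\<exists>H\<in>hyp ` N. shard a n \<in> shards_in (hyp ` N) (region {}) H \<and>
      H \<notin> sep_set (hyp ` N) (region {}) (region w)) \<longleftrightarrow> n \<notin> w"
    using n by auto
qed

lemma upper_regions_shard:
  assumes e: "cover_edge chambers a n"
  shows "upper_regions (hyp ` N) (region {}) (shard a n) =
    {region (insert n c) | c. cover_edge chambers c n \<and> (\<forall>k. cutter k n \<longrightarrow> (k \<in> a \<longleftrightarrow> k \<in> c))}"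
    (is "?L = ?R")
proof
  have n: "n \<in> N"
    using e cover_edge_iff by blast
  show "?L \<subseteq> ?R"
  proof
    fix R
    assume "R \<in> ?L"
    then obtain w where w: "w \<in> chambers" "R = region w" "n \<in> w"
      "aff_dim (region w \<inter> shard a n) = int DIM('a) - 1"
      unfolding upper_regions_def regions_eq using sep_shard(1)[OF e] by auto
    have "N \<inter> w - {n} = w - {n}" "insert n (w - {n}) = w"
      using chambers_subset[OF w(1)] w(3) by auto
    then show "R \<in> ?R"
      using w(2) w(4)[unfolded region_meets_shard[OF e]]
      by (intro CollectI exI[of _ "w - {n}"]) simp
  qed
  show "?R \<subseteq> ?L"
  proof
    fix R
    assume "R \<in> ?R"
    then obtain c where c: "R = region (insert n c)" "cover_edge chambers c n"
      "\<forall>k. cutter k n \<longrightarrow> (k \<in> a \<longleftrightarrow> k \<in> c)"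
      by blast
    have "c \<in> chambers" "insert n c \<in> chambers" "n \<notin> c"
      using c(2) unfolding cover_edge_def by auto
    moreover have "N \<inter> insert n c - {n} = c"
      using calculation chambers_subset by blast
    ultimately show "R \<in> ?L"
      unfolding upper_regions_def regions_eq
      using c region_meets_shard[OF e, of "insert n c"] sep_shard(1)[OF e, of "insert n c"] by auto
  qed
qed

lemma lower_regions_shard:
  assumes e: "cover_edge chambers a n"
  shows "lower_regions (hyp ` N) (region {}) (shard a n) =
    {region c | c. cover_edge chambers c n \<and> (\<forall>k. cutter k n \<longrightarrow> (k \<in> a \<longleftrightarrow> k \<in> c))}"
    (is "?L = ?R")
proof
  show "?L \<subseteq> ?R"
  proof
    fix R
    assume "R \<in> ?L"
    then obtain w where w: "w \<in> chambers" "R = region w" "n \<notin> w"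
      "aff_dim (region w \<inter> shard a n) = int DIM('a) - 1"
      unfolding lower_regions_def regions_eq using sep_shard(2)[OF e] by auto
    have "N \<inter> w - {n} = w"
      using chambers_subset[OF w(1)] w(3) by auto
    then show "R \<in> ?R"
      using w(2) w(4)[unfolded region_meets_shard[OF e]] by force
  qed
  show "?R \<subseteq> ?L"
  proof
    fix R
    assume "R \<in> ?R"
    then obtain c where c: "R = region c" "cover_edge chambers c n"
      "\<forall>k. cutter k n \<longrightarrow> (k \<in> a \<longleftrightarrow> k \<in> c)"
      by blast
    have "c \<in> chambers" "n \<notin> c"
      using c(2) unfolding cover_edge_def by auto
    moreover have "N \<inter> c - {n} = c"
      using calculation chambers_subset by blast
    ultimately show "R \<in> ?L"
      unfolding lower_regions_def regions_eq
      using c region_meets_shard[OF e, of c] sep_shard(2)[OF e, of c] by auto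
  qed
qed

end

section \<open>The factorization system of shards\<close>

lemma Pos_simps:
  "carrier (Pos A B) = regions A" "x .=\<^bsub>Pos A B\<^esub> y \<longleftrightarrow> x = y"
  by (simp_all add: Pos_def)

locale tight_normal_system = normal_system +
  assumes tight: "tight (hyp ` N) (region {})"
begin

sublocale polygonal_system N chambers "\<lambda>k l. N \<inter> closed_segment k l" cutter
  using polygonal_system tight_polygon[OF tight] by blast

lemma carrier_Pos: "carrier (Pos (hyp ` N) (region {})) = region ` chambers"
  by (simp add: Pos_simps regions_eq)

lemma shard_cong:
  assumes "agree n a a'"
  shows "shard a n = shard a' n"
  unfolding shard_def using assms by (intro sign_cone_cong) (auto simp: agree_def)

text \<open>All walls of the shard share \<open>downmost\<close>, so this region lies below every
  upper region; by \<open>agree_downmost\<close> it is an upper region itself. A least element is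
  the only minimal one, so the definite description is resolved.\<close>

lemma J_shard:
  assumes e: "cover_edge chambers a n"
  shows "J (hyp ` N) (region {}) (shard a n) = region (downmost a n)"
proof -
  let ?P = "Pos (hyp ` N) (region {})" and ?U = "upper_regions (hyp ` N) (region {}) (shard a n)"
  note d = downmost[OF e]
  have U: "?U = {region (insert n c) | c. cover_edge chambers c n \<and> agree n a c}"
    using upper_regions_shard[OF e] unfolding agree_def .
  have "cover_edge chambers (downmost a n - {n}) n \<and> agree n a (downmost a n - {n})"
    using cover_edge_downmost[OF e] agree_downmost[OF e] by blast
  moreover have "insert n (downmost a n - {n}) = downmost a n"
    using d(3) by blast
  ultimately have mem: "region (downmost a n) \<in> ?U"
    unfolding U by (intro CollectI exI[of _ "downmost a n - {n}"]) simp
  have le: "\<exists>w\<in>chambers. Q = region w \<and> downmost a n \<subseteq> w" if "Q \<in> ?U" for Q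
  proof -
    obtain c where c: "Q = region (insert n c)" "cover_edge chambers c n" "agree n a c"
      using \<open>Q \<in> ?U\<close> unfolding U by blast
    then have "downmost a n \<subseteq> insert n c" "insert n c \<in> chambers"
      using agree_imp_extremes_eq[OF e c(2,3)] downmost(2)[OF c(2)]
      unfolding cover_edge_def by auto
    then show ?thesis
      using c(1) by blast
  qed
  show ?thesis
    unfolding J_def
  proof (rule the_equality)
    have "Q = region (downmost a n)" if Q: "Q \<in> ?U" "Q \<sqsubseteq>\<^bsub>?P\<^esub> region (downmost a n)" for Q
    proof -
      obtain w where w: "w \<in> chambers" "Q = region w" "downmost a n \<subseteq> w"
        using le[OF Q(1)] by blast
      then have "w \<subseteq> downmost a n"
        using Q(2) le_region d(1) by blast
      then show ?thesis
        using w by auto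
    qed
    then show "region (downmost a n) \<in> ?U \<and>
        (\<forall>Q\<in>?U. Q \<sqsubseteq>\<^bsub>?P\<^esub> region (downmost a n) \<longrightarrow> Q = region (downmost a n))"
      using mem by blast
  next
    fix R
    assume R: "R \<in> ?U \<and> (\<forall>Q\<in>?U. Q \<sqsubseteq>\<^bsub>?P\<^esub> R \<longrightarrow> Q = R)"
    then obtain w where w: "w \<in> chambers" "R = region w" "downmost a n \<subseteq> w"
      using le by blast
    then have "region (downmost a n) \<sqsubseteq>\<^bsub>?P\<^esub> R"
      using le_region d(1) by blast
    then show "R = region (downmost a n)"
      using R mem by blast
  qed
qed

lemma M_shard:
  assumes e: "cover_edge chambers a n"
  shows "M (hyp ` N) (region {}) (shard a n) = region (upmost a n)"
proof -
  let ?P = "Pos (hyp ` N) (region {})" and ?U = "lower_regions (hyp ` N) (region {}) (shard a n)"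
  note d = upmost[OF e]
  have U: "?U = {region c | c. cover_edge chambers c n \<and> agree n a c}"
    using lower_regions_shard[OF e] unfolding agree_def .
  have mem: "region (upmost a n) \<in> ?U"
    unfolding U using cover_edge_upmost[OF e] agree_upmost[OF e] by blast
  have le: "\<exists>w\<in>chambers. Q = region w \<and> w \<subseteq> upmost a n" if "Q \<in> ?U" for Q
  proof -
    obtain c where c: "Q = region c" "cover_edge chambers c n" "agree n a c"
      using \<open>Q \<in> ?U\<close> unfolding U by blast
    then have "c \<subseteq> upmost a n" "c \<in> chambers"
      using agree_imp_extremes_eq[OF e c(2,3)] upmost(2)[OF c(2)]
      unfolding cover_edge_def by auto
    then show ?thesis
      using c(1) by blast
  qed
  show ?thesis
    unfolding M_def
  proof (rule the_equality)
    have "Q = region (upmost a n)" if Q: "Q \<in> ?U" "region (upmost a n) \<sqsubseteq>\<^bsub>?P\<^esub> Q" for Q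
    proof -
      obtain w where w: "w \<in> chambers" "Q = region w" "w \<subseteq> upmost a n"
        using le[OF Q(1)] by blast
      then have "upmost a n \<subseteq> w"
        using Q(2) le_region d(1) by blast
      then show ?thesis
        using w by auto
    qed
    then show "region (upmost a n) \<in> ?U \<and>
        (\<forall>Q\<in>?U. region (upmost a n) \<sqsubseteq>\<^bsub>?P\<^esub> Q \<longrightarrow> Q = region (upmost a n))"
      using mem by blast
  next
    fix R
    assume R: "R \<in> ?U \<and> (\<forall>Q\<in>?U. R \<sqsubseteq>\<^bsub>?P\<^esub> Q \<longrightarrow> Q = R)"
    then obtain w where w: "w \<in> chambers" "R = region w" "w \<subseteq> upmost a n"
      using le by blast
    then have "R \<sqsubseteq>\<^bsub>?P\<^esub> region (upmost a n)"
      using le_region d(1) by blast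
    then show "R = region (upmost a n)"
      using R mem by blast
  qed
qed

lemma partial_order_Pos: "partial_order (Pos (hyp ` N) (region {}))"
proof unfold_locales
  fix x y
  assume "x \<sqsubseteq>\<^bsub>Pos (hyp ` N) (region {})\<^esub> y" "y \<sqsubseteq>\<^bsub>Pos (hyp ` N) (region {})\<^esub> x"
    "x \<in> carrier (Pos (hyp ` N) (region {}))" "y \<in> carrier (Pos (hyp ` N) (region {}))"
  then show "x .=\<^bsub>Pos (hyp ` N) (region {})\<^esub> y"
    unfolding carrier_Pos using le_region by (auto simp: Pos_simps(2))
qed (auto simp: Pos_def)

lemma separating_pairs_shards:
  "separating_pairs (Pos (hyp ` N) (region {})) (Sh (hyp ` N) (region {}))
    (J (hyp ` N) (region {})) (M (hyp ` N) (region {}))"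
  (is "separating_pairs ?P ?S ?J ?M")
proof -
  interpret partial_order ?P
    by (rule partial_order_Pos)
  have edge: "\<exists>a n. x = shard a n \<and> cover_edge chambers a n \<and>
      ?J x = region (downmost a n) \<and> ?M x = region (upmost a n)" if "x \<in> ?S" for x
    using that J_shard M_shard unfolding Sh_eq by blast
  have eqs: "shard a n = shard a' n'"
    if "cover_edge chambers a n" "cover_edge chambers a' n'"
      "downmost a n = downmost a' n' \<or> upmost a n = upmost a' n'" for a n a' n'
    using downmost_inj[OF that(1,2)] upmost_inj[OF that(1,2)] that(3) shard_cong by metis
  show ?thesis
  proof unfold_locales
    fix x
    assume "x \<in> ?S"
    then obtain a n where x: "x = shard a n" "cover_edge chambers a n"
      "?J x = region (downmost a n)" "?M x = region (upmost a n)"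
      using edge by blast
    show "?J x \<in> carrier ?P" "?M x \<in> carrier ?P"
      unfolding carrier_Pos x(3,4) using downmost(1)[OF x(2)] upmost(1)[OF x(2)] by auto
    show "\<not> ?J x \<sqsubseteq>\<^bsub>?P\<^esub> ?M x"
      unfolding x(3,4) le_region[OF downmost(1)[OF x(2)] upmost(1)[OF x(2)]]
      by (rule downmost_not_le_upmost[OF x(2)])
  next
    fix u v
    assume uv: "u \<in> carrier ?P" "v \<in> carrier ?P" "\<not> u \<sqsubseteq>\<^bsub>?P\<^esub> v"
    then obtain u' v' where u': "u' \<in> chambers" "u = region u'" "v' \<in> chambers" "v = region v'"
      unfolding carrier_Pos by blast
    then obtain a n where a: "cover_edge chambers a n" "downmost a n \<subseteq> u'" "v' \<subseteq> upmost a n"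
      using separating_edge[of u' v'] uv(3) le_region by blast
    then show "\<exists>x\<in>?S. ?J x \<sqsubseteq>\<^bsub>?P\<^esub> u \<and> v \<sqsubseteq>\<^bsub>?P\<^esub> ?M x"
      unfolding Sh_eq u'(2,4)
      using J_shard[OF a(1)] M_shard[OF a(1)] le_region[OF downmost(1)[OF a(1)] u'(1)]
        le_region[OF u'(3) upmost(1)[OF a(1)]]
      by (intro bexI[of _ "shard a n"]) auto
  next
    fix x y
    assume "x \<in> ?S" "y \<in> ?S"
    then obtain a n a' n' where x: "x = shard a n" "cover_edge chambers a n"
        "?J x = region (downmost a n)" "?M x = region (upmost a n)"
      and y: "y = shard a' n'" "cover_edge chambers a' n'"
        "?J y = region (downmost a' n')" "?M y = region (upmost a' n')"
      using edge by metis
    note dx = downmost(1)[OF x(2)] upmost(1)[OF x(2)] and dy = downmost(1)[OF y(2)] upmost(1)[OF y(2)]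
    show "x = y" if "?J x = ?J y"
      using that region_inj[OF dx(1) dy(1)] eqs[OF x(2) y(2)] x y by metis
    show "x = y" if "?M x = ?M y"
      using that region_inj[OF dx(2) dy(2)] eqs[OF x(2) y(2)] x y by metis
    show "x = y" if le: "?J y \<sqsubseteq>\<^bsub>?P\<^esub> ?J x" "?M x \<sqsubseteq>\<^bsub>?P\<^esub> ?M y"
    proof -
      have "downmost a' n' \<subseteq> downmost a n" "upmost a n \<subseteq> upmost a' n'"
        using le unfolding x(3,4) y(3,4) le_region[OF dy(1) dx(1)] le_region[OF dx(2) dy(2)] .
      then show ?thesis
        using extremes_acyclic[OF x(2) y(2)] eqs[OF x(2) y(2)] x(1) y(1) by simp
    qed
  next
    fix X
    assume "X \<subseteq> carrier ?P"
    then obtain X' where X': "X' \<subseteq> chambers" "X = region ` X'"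
      unfolding carrier_Pos by (meson subset_imageE)
    obtain s where s: "s \<in> chambers" "\<forall>x\<in>X'. x \<subseteq> s"
      "\<forall>u\<in>chambers. (\<forall>x\<in>X'. x \<subseteq> u) \<longrightarrow> s \<subseteq> u"
      using ex_lub[OF X'(1)] by blast
    have le: "region x \<sqsubseteq>\<^bsub>?P\<^esub> region u \<longleftrightarrow> x \<subseteq> u" if "x \<in> X'" "u \<in> chambers" for x u
      using le_region X'(1) that by blast
    have "region s \<in> Upper ?P X"
      unfolding Upper_def X'(2) carrier_Pos using s(1,2) le by auto
    moreover have "region s \<sqsubseteq>\<^bsub>?P\<^esub> U" if U: "U \<in> Upper ?P X" for U
    proof -
      obtain u where u: "u \<in> chambers" "U = region u"
        using U unfolding Upper_def carrier_Pos by blast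
      have "x \<subseteq> u" if x: "x \<in> X'" for x
      proof -
        have "region x \<in> X \<inter> carrier ?P"
          using x X' carrier_Pos by blast
        then have "region x \<sqsubseteq>\<^bsub>?P\<^esub> U"
          using U unfolding Upper_def by blast
        then show ?thesis
          using le[OF x u(1)] u(2) by simp
      qed
      then show ?thesis
        using s(1,3) u le_region[OF s(1) u(1)] by simp
    qed
    ultimately show "\<exists>s. is_lub ?P s X"
      unfolding least_def by (intro exI[of _ "region s"]) auto
  qed
qed

end

text \<open>\<open>b\<close> is any point of the open component whose closure is \<open>B\<close>;
  it lies on no hyperplane, so every normal can be rescaled.\<close>

lemma ex_normal_system:
  fixes A :: "'a::euclidean_space set set"
  assumes "arrangement A" "B \<in> regions A"
  shows "\<exists>N b. normal_system N b \<and> A = hyp ` N \<and> B = sign_cone UNIV N {}"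
proof -
  obtain K where K: "K \<in> components (UNIV - \<Union>A)" "B = closure K"
    using assms(2) unfolding regions_def by blast
  obtain b where b: "b \<in> UNIV - \<Union>A" "K = connected_component_set (UNIV - \<Union>A) b"
    using K(1) by (rule componentsE)
  have "\<exists>n. n \<bullet> b = -1 \<and> H = hyp n" if "H \<in> A" for H
  proof -
    have "subspace H" "dim H + 1 = DIM('a)"
      using assms(1) that unfolding arrangement_def by auto
    then obtain a where a: "a \<noteq> 0" "H = {x. a \<bullet> x = 0}"
      using dim_eq_hyperplane[of H] by (metis add_diff_cancel_right' span_eq_iff)
    have "a \<bullet> b \<noteq> 0"
      using a(2) b(1) that by blast
    \<comment> \<open>The factor \<open>- 1 / (a \<bullet> b)\<close> makes the value at
      \<open>b\<close> equal to \<open>-1\<close> and leaves the hyperplane unchanged.\<close>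
    then have "((- 1 / (a \<bullet> b)) *\<^sub>R a) \<bullet> b = -1" "H = hyp ((- 1 / (a \<bullet> b)) *\<^sub>R a)"
      unfolding a(2) hyp_def by auto
    then show ?thesis
      by blast
  qed
  then obtain f where f: "\<And>H. H \<in> A \<Longrightarrow> f H \<bullet> b = -1 \<and> H = hyp (f H)"
    by metis
  define N where "N = f ` A"
  have A: "A = hyp ` N"
    using f unfolding N_def by force
  have N: "normal_system N b"
    using f assms(1) unfolding N_def arrangement_def by unfold_locales auto
  then have nz: "\<forall>k\<in>N. k \<bullet> b \<noteq> 0"
    by (simp add: normal_system.normalised)
  have "pos N b = {}"
    using N by (rule normal_system.pos_b)
  then have "B = sign_cone UNIV N {}"
    using closure_sign_cell[OF subspace_UNIV UNIV_I nz]
      connected_component_complement[OF subspace_UNIV UNIV_I nz] K(2) b(2) A by simp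
  then show ?thesis
    using N A by blast
qed

theorem theorem8p2:
  fixes A :: "'a::euclidean_space set set" and B :: "'a set"
  assumes "arrangement A" and "B \<in> regions A" and "tight A B"
  shows "factorization_system (Sh A B) (shard_to A B) (shard_onto A B) (shard_into A B)
       \<and> two_acyclic (shard_onto A B) (shard_into A B)
       \<and> order_iso (Pos A B) (Pairs (Sh A B) (shard_to A B)) (region_pair A B)
       \<and> (\<forall>(X, Y) \<in> carrier (Pairs (Sh A B) (shard_to A B)).
            is_lub (Pos A B) (\<Squnion>\<^bsub>Pos A B\<^esub> (J A B ` X)) (J A B ` X)
          \<and> is_glb (Pos A B) (\<Sqinter>\<^bsub>Pos A B\<^esub> (M A B ` Y)) (M A B ` Y)
          \<and> \<Squnion>\<^bsub>Pos A B\<^esub> (J A B ` X) = \<Sqinter>\<^bsub>Pos A B\<^esub> (M A B ` Y)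
          \<and> inv_into (carrier (Pos A B)) (region_pair A B) (X, Y) = \<Squnion>\<^bsub>Pos A B\<^esub> (J A B ` X))"
proof -
  obtain N b where N: "normal_system N b" "A = hyp ` N" "B = sign_cone UNIV N {}"
    using ex_normal_system[OF assms(1,2)] by blast
  have B: "B = normal_system.region N {}"
    unfolding N(3) normal_system.region_def[OF N(1)] ..
  have "tight_normal_system N b"
    using N(1) assms(3) unfolding N(2) B by (intro tight_normal_system.intro tight_normal_system_axioms.intro)
  then interpret separating_pairs "Pos A B" "Sh A B" "J A B" "M A B"
    unfolding N(2) B by (rule tight_normal_system.separating_pairs_shards)
  have arrow: "arrow = shard_to A B"
    unfolding arrow_def shard_to_def ..
  have onto: "onto = shard_onto A B"
    unfolding onto_def shard_onto_def ..
  have into: "into = shard_into A B"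
    unfolding into_def shard_into_def ..
  have pair: "pair = region_pair A B"
    unfolding pair_def region_pair_def ..
  show ?thesis
    using factorization_system two_acyclic order_iso_pair Pairs_inverse
    unfolding arrow onto into pair by blast
qed

end
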